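(* Let $\pi=(d_1,\ldots,d_n)$ be a graphic sequence with $d_1\ge d_2\ge\cdots\ge d_n$, $d_n\ge 3$ and $d_{n-5}\ge 4$. Then $\pi$ has a $Z_3$-connected realization unless $\pi$ is $(5^2,3^4)$ or $(5,3^5)$.
   Context: A sequence of integers $\pi$ is graphic if there is a simple graph $G$ whose degree sequence is $\pi$; such $G$ is a realization of $\pi$. Exponents denote multiplicities, e.g. $(5^2,3^4)=(5,5,3,3,3,3)$. $Z_3$ is the cyclic group of order 3. For a graph $G$ with an orientation and a map $f:E(G)\to Z_3$, the boundary $\partial f:V(G)\to Z_3$ is $\partial f(v)=\sum_{e\text{ with tail }v}f(e)-\sum_{e\text{ with head }v}f(e)$. A map $b:V(G)\to Z_3$ is zero-sum if $\sum_{v}b(v)=0$. $G$ is $Z_3$-connected if for every zero-sum $b$ there exist an orientation of $G$ and a map $f:E(G)\to Z_3\setminus\{0\}$ with $\partial f=b$. A $Z_3$-connected realization of $\pi$ is a realization of $\pi$ that is $Z_3$-connected. *)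

theory Defs
  imports Main "HOL-Library.Multiset" "HOL-Library.Numeral_Type"
begin

text \<open>
  The numeral type \<open>3\<close> carries a \<open>comm_ring_1\<close> instance whose operations are
  arithmetic modulo 3; its additive group is the cyclic group of order 3.
\<close>

type_synonym Z3 = 3

definition simple_graph :: "'a set \<Rightarrow> 'a set set \<Rightarrow> bool" where
  "simple_graph V E \<longleftrightarrow> finite V \<and> (\<forall>e\<in>E. e \<subseteq> V \<and> card e = 2)"

definition degree :: "'a set set \<Rightarrow> 'a \<Rightarrow> nat" where
  "degree E v = card {e \<in> E. v \<in> e}"

definition realization :: "'a set \<Rightarrow> 'a set set \<Rightarrow> int list \<Rightarrow> bool" where
  "realization V E \<pi> \<longleftrightarrow>
     simple_graph V E \<and> image_mset (\<lambda>v. int (degree E v)) (mset_set V) = mset \<pi>"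

text \<open>
  Every finite graph is isomorphic to one whose vertices are natural numbers, so
  existence of a realization is stated for graphs on natural numbers.
\<close>

definition graphic :: "int list \<Rightarrow> bool" where
  "graphic \<pi> \<longleftrightarrow> (\<exists>(V :: nat set) E. realization V E \<pi>)"

text \<open>An orientation assigns to each edge its tail and its head.\<close>

definition orientation :: "'a set set \<Rightarrow> ('a set \<Rightarrow> 'a) \<Rightarrow> ('a set \<Rightarrow> 'a) \<Rightarrow> bool" where
  "orientation E tail head \<longleftrightarrow> (\<forall>e\<in>E. e = {tail e, head e})"

definition boundary ::
  "'a set set \<Rightarrow> ('a set \<Rightarrow> 'a) \<Rightarrow> ('a set \<Rightarrow> 'a) \<Rightarrow> ('a set \<Rightarrow> Z3) \<Rightarrow> 'a \<Rightarrow> Z3" where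
  "boundary E tail head f v =
     (\<Sum>e \<in> {e \<in> E. tail e = v}. f e) - (\<Sum>e \<in> {e \<in> E. head e = v}. f e)"

definition zero_sum :: "'a set \<Rightarrow> ('a \<Rightarrow> Z3) \<Rightarrow> bool" where
  "zero_sum V b \<longleftrightarrow> (\<Sum>v\<in>V. b v) = 0"

definition Z3_connected :: "'a set \<Rightarrow> 'a set set \<Rightarrow> bool" where
  "Z3_connected V E \<longleftrightarrow>
     (\<forall>b. zero_sum V b \<longrightarrow>
        (\<exists>tail head f. orientation E tail head \<and> (\<forall>e\<in>E. f e \<noteq> 0) \<and>
           (\<forall>v\<in>V. boundary E tail head f v = b v)))"

definition has_Z3_connected_realization :: "int list \<Rightarrow> bool" where
  "has_Z3_connected_realization \<pi> \<longleftrightarrow>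
     (\<exists>(V :: nat set) E. realization V E \<pi> \<and> Z3_connected V E)"

end

theory Submission
  imports Defs
begin

text \<open>
  Deleting a vertex of minimum degree \<open>d\<close> as in the Havel--Hakimi theorem lowers the \<open>d\<close>
  largest remaining degrees by one; conversely, attaching a vertex by at least two edges
  preserves \<open>Z\<^sub>3\<close>-connectivity. Hence one can induct on the number of vertices, under the
  invariant that all degrees are at least 3 and at most five of them equal 3, an invariant that
  is meaningful down to order 5. The induction step can fail only for the sequences
  \<open>(4\<^sup>a, 3\<^sup>4)\<close> and \<open>(d, 4\<^sup>a, 3\<^sup>5)\<close> with \<open>d\<close> odd, and for three sporadic sequences of length 7 and those
  of length 6 with at most two degrees above 3. The two families are built from a few small graphs
  by surrounding a \<open>Z\<^sub>3\<close>-connected graph with a 4-cycle (contracting the inner graph leaves the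
  wheel \<open>W\<^sub>4\<close>) and by attaching vertices.
\<close>

section \<open>Boundaries in multigraphs\<close>

text \<open>Multigraphs are unavoidable here. Attachments alone never build a simple graph with more
  than one vertex, since the second vertex would already need two parallel edges to the first. A
  lift at a cubic vertex whose neighbours are adjacent creates such a pair, but it only serves
  demands that are nonzero at that vertex. Every basic graph therefore needs a separate argument for
  demands vanishing at its cubic vertices: an explicit flow for the wheel, a finite table for the
  certified graphs. The shape of the two families comes from counting 3s. Deleting a vertex of
  degree 3 removes one 3 and turns each 4 among the three lowered degrees into a 3. Starting from at
  most five 3s, the bound can break only if two of these three degrees are 4, and then every degree
  except possibly the largest is 3 or 4. Parity fixes the rest. The sporadic sequences have another
  origin: their reduction either is one of the two excluded sequences or contains a 2.\<close>

definition unit_flow :: "'a \<Rightarrow> 'a \<Rightarrow> 'a \<Rightarrow> Z3" where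
  "unit_flow x y v = of_bool (v = x) - of_bool (v = y)"

definition net :: "('a \<times> 'a) multiset \<Rightarrow> 'a \<Rightarrow> Z3" where
  "net D v = (\<Sum>(x, y)\<in>#D. unit_flow x y v)"

definition ends :: "'a \<times> 'a \<Rightarrow> 'a set" where
  "ends d = {fst d, snd d}"

text \<open>
  Multigraphs are multisets of endpoint sets. The nonzero elements of \<open>Z\<^sub>3\<close> are \<open>\<plusminus>1\<close>, and \<open>-1\<close> can be
  traded for a reversal of the edge, so a nowhere-zero map amounts to an orientation.
\<close>

definition flows :: "'a set multiset \<Rightarrow> ('a \<Rightarrow> Z3) \<Rightarrow> bool" where
  "flows L b \<longleftrightarrow> (\<exists>D. image_mset ends D = L \<and> b = net D)"

text \<open>The map has to vanish off \<open>V\<close> because \<open>flows\<close> compares it with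
  \<open>net D\<close> on the whole type, where an arc contributes only at its ends.\<close>

definition demand :: "'a set \<Rightarrow> ('a \<Rightarrow> Z3) \<Rightarrow> bool" where
  "demand V b \<longleftrightarrow> finite V \<and> (\<forall>v. v \<notin> V \<longrightarrow> b v = 0) \<and> sum b V = 0"

definition conn :: "'a set \<Rightarrow> 'a set multiset \<Rightarrow> bool" where
  "conn V L \<longleftrightarrow> (\<forall>b. demand V b \<longrightarrow> flows L b)"

lemma Z3_cases: "x = 0 \<or> x = 1 \<or> x = 2" for x :: Z3
proof (cases x rule: bit1_cases)
  case (of_int z)
  then have "z = 0 \<or> z = 1 \<or> z = 2" by auto
  with of_int show ?thesis by auto
qed

lemma net_empty [simp]: "net {#} = (\<lambda>v. 0)"
  by (simp add: net_def fun_eq_iff)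

lemma net_add_mset [simp]: "net (add_mset (x, y) D) = (\<lambda>v. unit_flow x y v + net D v)"
  by (simp add: net_def fun_eq_iff)

lemma ends_Pair [simp]: "ends (x, y) = {x, y}"
  by (simp add: ends_def)

lemma flows_empty: "flows {#} (\<lambda>v. 0)"
  by (simp add: flows_def)

lemma flows_add_mset:
  assumes "flows L (\<lambda>v. b v - unit_flow x y v)"
  shows "flows (add_mset {x, y} L) b"
proof -
  obtain D where D: "image_mset ends D = L" "(\<lambda>v. b v - unit_flow x y v) = net D"
    using assms by (auto simp: flows_def)
  have "b v = unit_flow x y v + net D v" for v
    using fun_cong[OF D(2), of v] by (simp add: algebra_simps)
  then show ?thesis using D(1)
    unfolding flows_def by (intro exI[of _ "add_mset (x, y) D"]) auto
qed

lemma flows_add_mset_rev: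
  assumes "flows L (\<lambda>v. b v - unit_flow y x v)"
  shows "flows (add_mset {x, y} L) b"
  using flows_add_mset[OF assms] by (simp add: insert_commute)

lemma flows_add_msetE:
  assumes "flows (add_mset {x, y} L) b"
  obtains "flows L (\<lambda>v. b v - unit_flow x y v)" | "flows L (\<lambda>v. b v - unit_flow y x v)"
proof -
  obtain D where D: "image_mset ends D = add_mset {x, y} L" "b = net D"
    using assms by (auto simp: flows_def)
  obtain D' d where D': "D = add_mset d D'" "ends d = {x, y}" "image_mset ends D' = L"
    using msed_map_invR[OF D(1)] by auto
  have "d = (x, y) \<or> d = (y, x)"
    using D'(2) by (cases d) (auto simp: doubleton_eq_iff)
  moreover have "flows L (\<lambda>v. b v - unit_flow p q v)" if "d = (p, q)" for p q
    using D(2) D'(1,3) that by (auto simp: flows_def)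
  ultimately show ?thesis using that by blast
qed

text \<open>A unit running along \<open>{x, y}\<close> in either direction can be rerouted through
  \<open>v\<close>, which it enters once and leaves once, so no net value changes.\<close>

lemma flows_lift:
  assumes "flows (add_mset {x, y} L) b"
  shows "flows (add_mset {v, x} (add_mset {v, y} L)) b"
  using assms
proof (cases rule: flows_add_msetE)
  case 1
  then have "flows L (\<lambda>u. b u - unit_flow x v u - unit_flow v y u)"
    by (simp add: unit_flow_def algebra_simps)
  then show ?thesis by (intro flows_add_mset_rev[of _ _ x v] flows_add_mset[of _ _ v y])
next
  case 2
  then have "flows L (\<lambda>u. b u - unit_flow v x u - unit_flow y v u)"
    by (simp add: unit_flow_def algebra_simps)
  then show ?thesis by (intro flows_add_mset[of _ _ v x] flows_add_mset_rev[of _ _ y v])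
qed

lemma sum_unit_flow:
  assumes "finite V" "x \<in> V" "y \<in> V"
  shows "sum (unit_flow x y) V = 0"
proof -
  have "(\<Sum>v\<in>V. of_bool (v = z) :: Z3) = 1" if "z \<in> V" for z
  proof -
    have "(\<Sum>v\<in>V. of_bool (v = z) :: Z3) = (\<Sum>v\<in>V. if v = z then 1 else 0)"
      by (intro sum.cong) auto
    then show ?thesis using assms(1) that by simp
  qed
  then show ?thesis
    using assms unfolding unit_flow_def by (simp add: sum_subtractf)
qed

lemma demand_diff:
  assumes "demand V b" "x \<in> V" "y \<in> V"
  shows "demand V (\<lambda>v. b v - unit_flow x y v)"
  using assms sum_unit_flow[of V x y]
  by (auto simp: demand_def sum_subtractf) (auto simp: unit_flow_def)

lemma demand_remove:
  assumes "demand (insert v V) b" "v \<notin> V" "b v = 0"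
  shows "demand V b"
  using assms by (auto simp: demand_def)

lemma conn_singleton: "conn {v} {#}"
  unfolding conn_def
proof (intro allI impI)
  fix b :: "'a \<Rightarrow> Z3"
  assume "demand {v} b"
  then have "b = (\<lambda>u. 0)" by (auto simp: demand_def fun_eq_iff)
  then show "flows {#} b" by (simp add: flows_empty)
qed

lemma conn_add_edge:
  assumes "conn V L" "x \<in> V" "y \<in> V"
  shows "conn V (add_mset {x, y} L)"
  using assms demand_diff flows_add_mset unfolding conn_def by metis

text \<open>Two edges at \<open>v\<close> produce every residue there: both out give 2, both in give
  -2 = 1, one of each gives 0. What remains is a demand on \<open>V\<close>. The ends
  \<open>x\<close> and \<open>y\<close> may coincide, so a parallel pair is enough.\<close>

lemma conn_attach:
  assumes "conn V L" "v \<notin> V" "x \<in> V" "y \<in> V"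
  shows "conn (insert v V) (add_mset {v, x} (add_mset {v, y} L))"
  unfolding conn_def
proof (intro allI impI)
  fix b :: "'a \<Rightarrow> Z3"
  assume b: "demand (insert v V) b"
  have ne: "x \<noteq> v" "y \<noteq> v" using assms by auto
  have *: "flows L b'" if "demand (insert v V) b'" "b' v = 0" for b'
    using assms(1) demand_remove[OF that(1) assms(2) that(2)] by (simp add: conn_def)
  consider "b v = 0" | "b v = 1" | "b v = 2" using Z3_cases by blast
  then show "flows (add_mset {v, x} (add_mset {v, y} L)) b"
  proof cases
    case 1
    have "flows L (\<lambda>u. b u - unit_flow v x u - unit_flow y v u)"
      by (intro * demand_diff b) (simp_all add: assms(3,4) unit_flow_def 1 ne ne[symmetric])
    then show ?thesis by (intro flows_add_mset[of _ _ v x] flows_add_mset_rev[of _ _ y v])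
  next
    case 2
    have "flows L (\<lambda>u. b u - unit_flow x v u - unit_flow y v u)"
      by (intro * demand_diff b) (simp_all add: assms(3,4) unit_flow_def 2 ne ne[symmetric])
    then show ?thesis by (intro flows_add_mset_rev[of _ _ x v] flows_add_mset_rev[of _ _ y v])
  next
    case 3
    have "flows L (\<lambda>u. b u - unit_flow v x u - unit_flow v y u)"
      by (intro * demand_diff b) (simp_all add: assms(3,4) unit_flow_def 3 ne ne[symmetric])
    then show ?thesis by (intro flows_add_mset[of _ _ v x] flows_add_mset[of _ _ v y])
  qed
qed

text \<open>
  At a vertex of degree 3 with nonzero demand, one edge (here \<open>{v, z}\<close>) can be made to carry the
  demand while the other two are traversed consecutively.
\<close>

lemma flows_cubic_vertex:
  assumes "conn V (add_mset {x, y} L)" "v \<notin> V" "x \<in> V" "y \<in> V" "z \<in> V"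
    and b: "demand (insert v V) b" and "b v \<noteq> 0"
  shows "flows (add_mset {v, z} (add_mset {v, x} (add_mset {v, y} L))) b"
proof -
  have ne: "z \<noteq> v" using assms by auto
  have *: "flows (add_mset {v, x} (add_mset {v, y} L)) b'"
    if "demand (insert v V) b'" "b' v = 0" for b'
    using assms(1) demand_remove[OF that(1) assms(2) that(2)] by (intro flows_lift) (simp add: conn_def)
  consider "b v = 1" | "b v = 2" using Z3_cases[of "b v"] assms(7) by auto
  then show ?thesis
  proof cases
    case 1
    have "flows (add_mset {v, x} (add_mset {v, y} L)) (\<lambda>u. b u - unit_flow v z u)"
      by (intro * demand_diff b) (simp_all add: assms(5) unit_flow_def 1 ne ne[symmetric])
    then show ?thesis by (rule flows_add_mset)
  next
    case 2
    have "flows (add_mset {v, x} (add_mset {v, y} L)) (\<lambda>u. b u - unit_flow z v u)"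
      by (intro * demand_diff b) (simp_all add: assms(5) unit_flow_def 2 ne ne[symmetric])
    then show ?thesis by (rule flows_add_mset_rev)
  qed
qed

lemma conn_mono:
  assumes "conn V H" "H \<subseteq># L" "\<forall>e\<in>#L. \<exists>x\<in>V. \<exists>y\<in>V. e = {x, y}"
  shows "conn V L"
proof -
  have "conn V (H + K)" if "\<forall>e\<in>#K. \<exists>x\<in>V. \<exists>y\<in>V. e = {x, y}" for K
    using that
  proof (induction K)
    case empty
    then show ?case using assms(1) by simp
  next
    case (add e K)
    obtain x y where "x \<in> V" "y \<in> V" "e = {x, y}" using add.prems by auto
    then show ?case using add conn_add_edge[of V "H + K" x y] by simp
  qed
  from this[of "L - H"] show ?thesis
    using assms(2,3) by (auto dest: in_diffD)
qed

section \<open>Surrounding a graph by a 4-cycle\<close>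

text \<open>A rim \<open>p q r s\<close> with one spoke at each rim vertex. The inner ends may
  coincide: if all are equal this is the wheel itself, and a partial coincidence gives one inner
  vertex several spokes.\<close>

definition wheel_edges ::
  "'a \<Rightarrow> 'a \<Rightarrow> 'a \<Rightarrow> 'a \<Rightarrow> 'a \<Rightarrow> 'a \<Rightarrow> 'a \<Rightarrow> 'a \<Rightarrow> 'a set multiset" where
  "wheel_edges p q r s a b c d =
     {#{p, q}, {q, r}, {r, s}, {s, p}, {p, a}, {q, b}, {r, c}, {s, d}#}"

lemma wheel_edges_rotate: "wheel_edges p q r s a b c d = wheel_edges q r s p b c d a"
  by (simp add: wheel_edges_def add_mset_commute insert_commute)

text \<open>The lift at \<open>p\<close> replaces \<open>{p, q}\<close> and \<open>{p, a}\<close> by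
  \<open>{q, a}\<close>, while \<open>{p, s}\<close> carries the demand of \<open>p\<close>. Then
  \<open>q\<close> has two edges into \<open>V\<close>, and \<open>r\<close> and \<open>s\<close> in
  turn have two edges each to what is already built, so three attachments suffice.\<close>

lemma flows_surround:
  assumes "conn V L" "distinct [p, q, r, s]" "{p, q, r, s} \<inter> V = {}" "{a, b, c, d} \<subseteq> V"
    and "demand ({p, q, r, s} \<union> V) f" "f p \<noteq> 0"
  shows "flows (wheel_edges p q r s a b c d + L) f"
proof -
  have "conn (insert s (insert r (insert q V)))
      (add_mset {s, r} (add_mset {s, d} (add_mset {r, q} (add_mset {r, c}
        (add_mset {q, a} (add_mset {q, b} L))))))"
    using assms(2-4) by (intro conn_attach assms(1)) auto
  then have "conn (insert s (insert r (insert q V)))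
      (add_mset {q, a} (add_mset {s, r} (add_mset {s, d} (add_mset {r, q} (add_mset {r, c}
         (add_mset {q, b} L))))))"
    by (simp add: add_mset_commute)
  then have "flows (add_mset {p, s} (add_mset {p, q} (add_mset {p, a}
       (add_mset {s, r} (add_mset {s, d} (add_mset {r, q} (add_mset {r, c}
         (add_mset {q, b} L)))))))) f"
    by (rule flows_cubic_vertex) (use assms(2-6) in \<open>auto simp: insert_commute\<close>)
  then show ?thesis
    by (simp add: wheel_edges_def add_mset_commute insert_commute)
qed

lemma conn_surround:
  assumes L: "conn V L" and d: "distinct [p, q, r, s]" and i: "{p, q, r, s} \<inter> V = {}"
    and V: "{a, b, c, d} \<subseteq> V"
  shows "conn ({p, q, r, s} \<union> V) (wheel_edges p q r s a b c d + L)"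
  unfolding conn_def
proof (intro allI impI)
  fix f :: "'a \<Rightarrow> Z3"
  assume f: "demand ({p, q, r, s} \<union> V) f"
  consider "f p \<noteq> 0" | "f q \<noteq> 0" | "f r \<noteq> 0" | "f s \<noteq> 0"
    | "f p = 0" "f q = 0" "f r = 0" "f s = 0" by blast
  then show "flows (wheel_edges p q r s a b c d + L) f"
  proof cases
    case 1
    with flows_surround[OF assms f] show ?thesis .
  next
    case 2
    have "demand ({q, r, s, p} \<union> V) f" using f by (simp add: insert_commute)
    with 2 have "flows (wheel_edges q r s p b c d a + L) f"
      by (intro flows_surround[OF L]) (use d i V in auto)
    then show ?thesis by (simp only: wheel_edges_rotate[of p])
  next
    case 3
    have "demand ({r, s, p, q} \<union> V) f" using f by (simp add: insert_commute)
    with 3 have "flows (wheel_edges r s p q c d a b + L) f"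
      by (intro flows_surround[OF L]) (use d i V in auto)
    then show ?thesis by (simp only: wheel_edges_rotate[of p] wheel_edges_rotate[of q])
  next
    case 4
    have "demand ({s, p, q, r} \<union> V) f" using f by (simp add: insert_commute)
    with 4 have "flows (wheel_edges s p q r d a b c + L) f"
      by (intro flows_surround[OF L]) (use d i V in auto)
    then show ?thesis by (simp only: wheel_edges_rotate[of s])
  next
    case 5
    let ?W = "{p, q, r, s} \<union> V"
    have ne: "p \<noteq> q" "p \<noteq> r" "p \<noteq> s" "q \<noteq> r" "q \<noteq> s" "r \<noteq> s"
      using d by auto
    have ne': "p \<noteq> a" "p \<noteq> b" "p \<noteq> c" "p \<noteq> d" "q \<noteq> a" "q \<noteq> b" "q \<noteq> c" "q \<noteq> d"
      "r \<noteq> a" "r \<noteq> b" "r \<noteq> c" "r \<noteq> d" "s \<noteq> a" "s \<noteq> b" "s \<noteq> c" "s \<noteq> d"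
      using i V by auto
    \<comment> \<open>No rim vertex admits a lift now. Since the rim is an even cycle,
      \<open>p\<close> and \<open>r\<close> can be made sources and \<open>q\<close> and
      \<open>s\<close> sinks: all three edges leave or all three enter, which gives 3 = 0 or -3 =
      0.\<close>
    define g where "g = (\<lambda>v. f v - unit_flow p q v - unit_flow r q v - unit_flow r s v - unit_flow p s v
      - unit_flow p a v - unit_flow b q v - unit_flow r c v - unit_flow d s v)"
    have "demand ?W g"
      unfolding g_def using V by (intro demand_diff f) auto
    moreover have "g p = 0" "g q = 0" "g r = 0" "g s = 0"
      by (simp_all add: g_def unit_flow_def 5 ne ne[symmetric] ne')
    ultimately have "demand V g"
      using d i by (auto simp: demand_def sum.insert_if)
    with L have "flows L g" by (simp add: conn_def)
    then
    have "flows (add_mset {p, q} (add_mset {q, r} (add_mset {r, s} (add_mset {s, p}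
        (add_mset {p, a} (add_mset {q, b} (add_mset {r, c} (add_mset {s, d} L)))))))) f"
      unfolding g_def
      by (intro flows_add_mset[of _ _ p q] flows_add_mset_rev[of _ _ r q]
          flows_add_mset[of _ _ r s] flows_add_mset_rev[of _ _ p s]
          flows_add_mset[of _ _ p a] flows_add_mset_rev[of _ _ b q]
          flows_add_mset[of _ _ r c] flows_add_mset_rev[of _ _ d s])
    then show ?thesis
      by (simp add: wheel_edges_def)
  qed
qed

section \<open>Certificates for small graphs\<close>

text \<open>The binary digits of \<open>w\<close> say which edges are reversed.\<close>

fun orient :: "('a \<times> 'a) list \<Rightarrow> nat \<Rightarrow> ('a \<times> 'a) list" where
  "orient [] w = []"
| "orient ((x, y) # L) w = (if even w then (x, y) else (y, x)) # orient L (w div 2)"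

lemma map_ends_orient: "map ends (orient L w) = map ends L"
  by (induction L w rule: orient.induct) auto

text \<open>
  The list of vertices is read from the right: every vertex has at least two edges to the
  vertices after it in the list.
\<close>

fun grows :: "('a \<times> 'a) list \<Rightarrow> 'a list \<Rightarrow> bool" where
  "grows L [] = False"
| "grows L [v] = True"
| "grows L (v # w # vs) \<longleftrightarrow> v \<notin> set (w # vs) \<and>
     2 \<le> length (filter (\<lambda>(x, y). x = v \<and> y \<in> set (w # vs) \<or> y = v \<and> x \<in> set (w # vs)) L) \<and>
     grows L (w # vs)"

lemma filter_ends_subset:
  "\<forall>e\<in>#{#e \<in># mset (map ends L). e \<subseteq> V#}. \<exists>x\<in>V. \<exists>y\<in>V. e = {x, y}"
  by (auto simp: ends_def)

lemma conn_grows: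
  assumes "grows L vs"
  shows "conn (set vs) {#e \<in># mset (map ends L). e \<subseteq> set vs#}"
  using assms
proof (induction L vs rule: grows.induct)
  case (2 L v)
  \<comment> \<open>Only loops at \<open>v\<close> can lie inside \<open>{v}\<close>, and
    \<open>conn_mono\<close> tolerates them.\<close>
  have "conn (set [v]) {#}" by (simp add: conn_singleton)
  from conn_mono[OF this empty_le filter_ends_subset] show ?case .
next
  case (3 L v w vs)
  let ?V = "set (w # vs)"
  define P where "P = (\<lambda>(x, y). x = v \<and> y \<in> ?V \<or> y = v \<and> x \<in> ?V)"
  have "2 \<le> length (filter P L)" using 3(2) by (simp add: P_def)
  then obtain d d' ds where ds: "filter P L = d # d' # ds"
    by (metis One_nat_def Suc_1 Suc_le_length_iff)
  have "d \<in> set (filter P L)" "d' \<in> set (filter P L)" unfolding ds by auto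
  then have "P d" "P d'" by auto
  then obtain x y where xy: "x \<in> ?V" "y \<in> ?V" "ends d = {v, x}" "ends d' = {v, y}"
    by (cases d; cases d') (auto simp: P_def insert_commute)
  have v: "v \<notin> ?V" using 3(2) by simp
  let ?H = "{#e \<in># mset (map ends L). e \<subseteq> ?V#}"
  have base: "conn (insert v ?V) (add_mset {v, x} (add_mset {v, y} ?H))"
    using 3 v xy by (intro conn_attach) auto
  have sub: "add_mset {v, x} (add_mset {v, y} ?H) \<subseteq>#
      {#e \<in># mset (map ends L). e \<subseteq> insert v ?V#}"
  proof -
    have "add_mset {v, x} (add_mset {v, y} {#}) \<subseteq># image_mset ends (mset (filter P L))"
      unfolding ds using xy by simp
    also have "\<dots> = image_mset ends {#d \<in># mset L. P d#}" by (simp add: mset_filter)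
    finally have "add_mset {v, x} (add_mset {v, y} ?H) \<subseteq>#
        image_mset ends {#d \<in># mset L. P d#} + ?H"
      using mset_subset_eq_mono_add_right_cancel[of "{#{v, x}, {v, y}#}" ?H] by simp
    also have "?H = image_mset ends {#d \<in># mset L. ends d \<subseteq> ?V#}"
      by (simp add: filter_mset_image_mset)
    also have "image_mset ends {#d \<in># mset L. P d#} + \<dots> =
        image_mset ends {#d \<in># mset L. P d \<or> ends d \<subseteq> ?V#}"
    proof -
      \<comment> \<open>An arc counted by \<open>P\<close> meets \<open>v\<close>, which lies
        outside \<open>?V\<close>, so no arc is counted twice.\<close>
      have "{#d \<in># mset L. P d#} + {#d \<in># mset L. ends d \<subseteq> ?V#} = {#d \<in># mset L. P d \<or> ends d \<subseteq> ?V#}"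
        using v by (intro multiset_eqI) (auto simp: P_def ends_def split: prod.splits)
      then show ?thesis by (metis image_mset_union)
    qed
    also have "\<dots> \<subseteq># image_mset ends {#d \<in># mset L. ends d \<subseteq> insert v ?V#}"
      by (intro image_mset_subseteq_mono mset_subset_eqI) (auto simp: P_def ends_def)
    also have "\<dots> = {#e \<in># mset (map ends L). e \<subseteq> insert v ?V#}"
      by (simp add: filter_mset_image_mset)
    finally show ?thesis by (simp add: filter_mset_image_mset)
  qed
  from conn_mono[OF base sub filter_ends_subset] show ?case by simp
qed simp

definition incident :: "'a \<Rightarrow> 'a \<times> 'a \<Rightarrow> bool" where
  "incident v = (\<lambda>(x, y). x = v \<or> y = v)"

definition other_end :: "'a \<Rightarrow> 'a \<times> 'a \<Rightarrow> 'a" where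
  "other_end v = (\<lambda>(x, y). if x = v then y else x)"

text \<open>
  Certifies all demands that are nonzero at the cubic vertex \<open>v\<close>, by the lift of its edges to
  \<open>x\<close> and \<open>y\<close>.
\<close>

fun lift_ok :: "nat \<Rightarrow> (nat \<times> nat) list \<Rightarrow> nat \<times> nat \<times> nat \<times> nat \<times> nat list \<Rightarrow> bool" where
  "lift_ok n L (v, x, y, z, vs) \<longleftrightarrow>
     map (other_end v) (filter (incident v) L) \<in> {[x, y, z], [x, z, y], [z, x, y]} \<and>
     sort (v # vs) = [0..<n] \<and> {x, y, z} \<subseteq> set vs \<and>
     grows ((x, y) # filter (\<lambda>d. \<not> incident v d) L) vs"

lemma flows_lift_ok:
  assumes ok: "lift_ok n L (v, x, y, z, vs)" and b: "demand {..<n} b" "b v \<noteq> 0"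
    and L: "\<And>x y. (x, y) \<in> set L \<Longrightarrow> x < n \<and> y < n"
  shows "flows (mset (map ends L)) b"
proof -
  let ?K = "filter (\<lambda>d. \<not> incident v d) L"
  note ok' = ok[unfolded lift_ok.simps]
  have srt: "sort (v # vs) = [0..<n]"
    and sub: "{x, y, z} \<subseteq> set vs"
    and grows: "grows ((x, y) # ?K) vs"
    and other: "map (other_end v) (filter (incident v) L) \<in> {[x, y, z], [x, z, y], [z, x, y]}"
    using ok' by blast+
  have V: "insert v (set vs) = {..<n}"
    by (metis srt atLeast_upt list.set(2) set_sort)
  have "distinct (v # vs)"
    by (metis srt distinct_sort distinct_upt)
  then have v: "v \<notin> set vs" by simp
  have "ends d \<subseteq> set vs" if "d \<in> set L" "\<not> incident v d" for d
  proof -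
    obtain p q where d: "d = (p, q)" by (cases d)
    have "p < n \<and> q < n" by (rule L) (use that(1) d in simp)
    moreover have "p \<noteq> v" "q \<noteq> v" using that(2) by (simp_all add: d incident_def)
    ultimately have "p \<in> insert v (set vs) \<and> p \<noteq> v" "q \<in> insert v (set vs) \<and> q \<noteq> v"
      unfolding V by simp_all
    then show ?thesis by (auto simp: d)
  qed
  then have "\<forall>e\<in>#mset (map ends ((x, y) # ?K)). e \<subseteq> set vs"
    using sub by auto
  then have filt: "{#e \<in># mset (map ends ((x, y) # ?K)). e \<subseteq> set vs#} = mset (map ends ((x, y) # ?K))"
    by (simp add: filter_mset_eq_conv)
  have xyz: "x \<in> set vs" "y \<in> set vs" "z \<in> set vs"
    using sub by simp_all
  have "conn (set vs) (add_mset {x, y} (mset (map ends ?K)))"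
    using conn_grows[OF grows] unfolding filt by simp
  then have "flows (add_mset {v, z} (add_mset {v, x} (add_mset {v, y} (mset (map ends ?K))))) b"
    by (rule flows_cubic_vertex) (use xyz v b V in simp_all)
  moreover have "mset (map ends L) =
      add_mset {v, z} (add_mset {v, x} (add_mset {v, y} (mset (map ends ?K))))"
  proof -
    have "mset (map ends L) = mset (map ends (filter (incident v) L)) + mset (map ends ?K)"
      by (simp flip: image_mset_union)
    also have "map ends (filter (incident v) L) =
        map (\<lambda>u. {v, u}) (map (other_end v) (filter (incident v) L))"
      by (auto simp: incident_def other_end_def)
    also have "mset \<dots> = {#{v, z}, {v, x}, {v, y}#}"
    proof -
      have "mset N = {#z, x, y#}" if "N \<in> {[x, y, z], [x, z, y], [z, x, y]}" for N
        using that by auto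
      from this[OF other] show ?thesis by (simp only: mset_map[of "\<lambda>u. {v, u}"]) simp
    qed
    finally show ?thesis by simp
  qed
  ultimately show ?thesis by simp
qed

definition net_list :: "nat \<Rightarrow> (nat \<times> nat) list \<Rightarrow> nat \<Rightarrow> Z3 list" where
  "net_list n L w = map (net (mset (orient L w))) [0..<n]"

text \<open>The shape of a zero-sum vector that is free up to some position: the next value balances
  the free ones, and zeros follow.\<close>

definition pad :: "nat \<Rightarrow> Z3 list \<Rightarrow> Z3 list" where
  "pad m c = c @ (- sum_list c) # replicate m 0"

text \<open>
  The vertices above \<open>k\<close> are handled by lifts; the remaining demands vanish there, are determined
  by their values below \<open>k\<close>, and are met by the orientations listed in \<open>ws\<close>.
\<close>

lemma conn_certificate:
  assumes "list_all (lift_ok n L) cs"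
    and ws: "map (net_list n L) ws = map (pad (n - Suc k)) (List.n_lists k [0, 1, 2])"
    and cs: "map fst cs = [Suc k..<n]" and "k < n"
    and L: "list_all (\<lambda>(x, y). x < n \<and> y < n) L"
  shows "conn {..<n} (mset (map ends L))"
  unfolding conn_def
proof (intro allI impI)
  fix b :: "nat \<Rightarrow> Z3"
  assume b: "demand {..<n} b"
  have L': "x < n \<and> y < n" if "(x, y) \<in> set L" for x y
    using L that by (auto simp: list_all_iff)
  show "flows (mset (map ends L)) b"
  proof (cases "\<exists>v. k < v \<and> b v \<noteq> 0")
    case True
    then obtain v where v: "k < v" "b v \<noteq> 0" by blast
    then have "v \<in> set (map fst cs)"
      unfolding cs using b by (auto simp: demand_def not_less[symmetric])
    then obtain x y z vs where "(v, x, y, z, vs) \<in> set cs" by auto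
    then have "lift_ok n L (v, x, y, z, vs)"
      using assms(1) by (auto simp: list_all_iff)
    then show ?thesis using flows_lift_ok b v(2) L' by blast
  next
    case False
    then have b0: "b v = 0" if "k < v" for v using that by blast
    define c where "c = map b [0..<k]"
    have "set c \<subseteq> {0, 1, 2}" using Z3_cases by auto
    then have "c \<in> set (List.n_lists k [0, 1, 2])"
      by (simp add: set_n_lists c_def)
    then have "pad (n - Suc k) c \<in> set (map (net_list n L) ws)"
      unfolding ws by simp
    then have "\<exists>w. map (net (mset (orient L w))) [0..<n] =
        c @ (- sum_list c) # replicate (n - Suc k) 0"
      unfolding net_list_def pad_def by (metis (no_types, lifting) imageE list.set_map)
    then obtain w where w: "map (net (mset (orient L w))) [0..<n] =
        c @ (- sum_list c) # replicate (n - Suc k) 0" ..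
    have "sum b {..<n} = sum b {..k}"
      using b0 \<open>k < n\<close> by (intro sum.mono_neutral_right) auto
    then have "sum b {..<k} + b k = 0"
      using b by (simp add: demand_def flip: lessThan_Suc_atMost)
    then have bk: "b k = - sum_list c"
      unfolding c_def by (simp add: interv_sum_list_conv_sum_set_nat lessThan_atLeast0 eq_neg_iff_add_eq_0 add.commute)
    have "net (mset (orient L w)) v = b v" for v
    proof (cases "v < n")
      case True
      then have "net (mset (orient L w)) v = (c @ (- sum_list c) # replicate (n - Suc k) 0) ! v"
        by (metis w add_0 diff_zero length_upt nth_map nth_upt)
      also have "\<dots> = b v"
      proof -
        consider "v < k" | "v = k" | i where "v = Suc (k + i)"
          by (metis less_imp_Suc_add linorder_neqE_nat)
        then show ?thesis
          using True b0 bk by cases (auto simp: nth_append c_def)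
      qed
      finally show ?thesis .
    next
      case False
      have "net (mset D) v = 0" if "\<forall>(x, y)\<in>set D. x < n \<and> y < n" for D
        using that False by (induction D) (auto simp: unit_flow_def)
      moreover have "\<forall>(x, y)\<in>set (orient L w). x < n \<and> y < n"
      proof -
        have "ends ` set (orient L w) = ends ` set L"
          using map_ends_orient[of L w] by (metis set_map)
        moreover have "ends d \<subseteq> {..<n}" if "d \<in> set L" for d
        proof -
          obtain p q where d: "d = (p, q)" by (cases d)
          have "p < n \<and> q < n" by (rule L') (use that d in simp)
          then show ?thesis by (simp add: d)
        qed
        ultimately have "\<forall>d\<in>set (orient L w). ends d \<subseteq> {..<n}" by (metis image_iff)
        then show ?thesis by (simp add: ends_def case_prod_beta)
      qed
      ultimately show ?thesis using False b by (simp add: demand_def)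
    qed
    then have "b = net (mset (orient L w))" by auto
    moreover have "image_mset ends (mset (orient L w)) = mset (map ends L)"
      by (metis map_ends_orient mset_map)
    ultimately show ?thesis unfolding flows_def by blast
  qed
qed


lemma n_lists_numeral:
  "List.n_lists (numeral v) xs =
    concat (map (\<lambda>ys. map (\<lambda>y. y # ys) xs) (List.n_lists (pred_numeral v) xs))"
  by (simp add: numeral_eq_Suc)

lemma replicate_numeral:
  "replicate (numeral v) x = x # replicate (pred_numeral v) x"
  by (simp add: numeral_eq_Suc)

lemma upt_6_7_8:
  "[0..<6] = [0, 1, 2, 3, 4, 5]" "[0..<7] = [0, 1, 2, 3, 4, 5, 6]"
  "[0..<8] = [0, 1, 2, 3, 4, 5, 6, 7]" "[Suc (Suc 0)..<n] = [2..<n]"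
  by (simp_all add: upt_rec eval_nat_numeral)

lemma net_add_mset_apply:
  "net (add_mset (x, y) D) v = unit_flow x y v + net D v" "net {#} v = 0"
  by simp_all

lemmas certificate_simps =
  insert_commute unit_flow_def n_lists_numeral incident_def other_end_def
  net_list_def pad_def replicate_numeral upt_6_7_8 net_add_mset_apply

section \<open>Certified realizations of (4^2,3^4), (5,4,3^5), (5,4^2,3^5), (4^4,3^4),
  (4^3,3^4)\<close>

definition edges_4433 :: "(nat \<times> nat) list" where
  "edges_4433 =
    [(0, 1), (0, 2), (0, 3), (0, 4), (1, 2), (1, 4), (1, 5), (2, 5), (3, 4), (3, 5)]"

text \<open>The cubic vertices are numbered last. Each of them lies in a triangle, so the lift
  doubles an existing edge, and the growth list ends with the two ends of that doubled edge. With
  \<open>k = 1\<close> only the value at vertex 0 is free; in general \<open>ws\<close> has 3^k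
  entries, in the order of \<open>List.n_lists\<close>.\<close>

lemma conn_4433: "conn {..<6} (mset (map ends edges_4433))"
proof (rule conn_certificate[where k = 1 and
      cs = "[(2, 0, 1, 5, [5, 3, 4, 1, 0]), (3, 0, 4, 5, [5, 2, 1, 4, 0]), (4, 0, 1, 3, [3, 5, 2, 1,
    0]), (5, 1, 2, 3, [3, 4, 0, 2, 1])]" and
      ws = "[22, 23, 1000]"])
qed (simp_all add: edges_4433_def certificate_simps del: net_add_mset)

definition edges_543 :: "(nat \<times> nat) list" where
  "edges_543 =
    [(0, 1), (0, 3), (0, 4), (0, 5), (0, 6), (1, 2), (1, 5), (1, 6), (2, 3), (2, 6), (3, 4),
    (4, 5)]"

lemma conn_543: "conn {..<7} (mset (map ends edges_543))"
proof (rule conn_certificate[where k = 1 and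
      cs = "[(2, 1, 6, 3, [3, 4, 5, 0, 6, 1]), (3, 0, 4, 2, [2, 6, 1, 5, 4, 0]), (4, 0, 5, 3, [3, 2,
    6, 1, 5, 0]), (5, 0, 1, 4, [4, 3, 2, 6, 1, 0]), (6, 0, 1, 2, [2, 3, 4, 5, 1, 0])]" and
      ws = "[1060, 1061, 3034]"])
qed (simp_all add: edges_543_def certificate_simps del: net_add_mset)

definition edges_5443 :: "(nat \<times> nat) list" where
  "edges_5443 =
    [(0, 1), (0, 2), (0, 3), (0, 5), (0, 7), (1, 2), (1, 6), (1, 7), (2, 4), (2, 6), (3, 4),
    (3, 5), (4, 6), (5, 7)]"

lemma conn_5443: "conn {..<8} (mset (map ends edges_5443))"
proof (rule conn_certificate[where k = 2 and
      cs = "[(3, 0, 5, 4, [4, 6, 2, 1, 7, 5, 0]), (4, 2, 6, 3, [3, 5, 7, 0, 1, 6, 2]), (5, 0, 7, 3,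
    [3, 4, 6, 2, 1, 7, 0]), (6, 1, 2, 4, [4, 3, 5, 7, 0, 2, 1]), (7, 0, 1, 5, [5, 3, 4, 6,
    2, 1, 0])]" and
      ws = "[3368, 3370, 13013, 13047, 3337, 3339, 3336, 3338, 3371]"])
qed (simp_all add: edges_5443_def certificate_simps del: net_add_mset)

definition edges_44443 :: "(nat \<times> nat) list" where
  "edges_44443 =
    [(0, 1), (0, 2), (0, 3), (0, 6), (1, 2), (1, 3), (1, 4), (2, 4), (2, 5), (3, 6), (3, 7),
    (4, 5), (5, 7), (6, 7)]"

lemma conn_44443: "conn {..<8} (mset (map ends edges_44443))"
proof (rule conn_certificate[where k = 3 and
      cs = "[(4, 1, 2, 5, [5, 7, 6, 3, 0, 2, 1]), (5, 2, 4, 7, [7, 6, 3, 0, 1, 4, 2]), (6, 0, 3, 7,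
    [7, 5, 4, 2, 1, 3, 0]), (7, 3, 6, 5, [5, 4, 2, 1, 0, 6, 3])]" and
      ws = "[2844, 2862, 2840, 2876, 2827, 2831, 2826, 2830, 2863, 2860, 13504, 2856, 2825, 2829,
    13540, 2828, 2861, 2824, 2842, 2846, 2879, 2874, 2878, 13522, 13558, 2843, 2847]"])
qed (simp_all add: edges_44443_def certificate_simps del: net_add_mset)

definition edges_4443 :: "(nat \<times> nat) list" where
  "edges_4443 =
    [(0, 1), (0, 2), (0, 5), (0, 6), (1, 2), (1, 4), (1, 5), (2, 3), (2, 6), (3, 4), (3, 5),
    (4, 6)]"

lemma conn_4443: "conn {..<7} (mset (map ends edges_4443))"
\<comment> \<open>Vertices 3 and 4 are cubic but lie in no triangle. Lifting there creates no
  parallel pair from which to grow, so they are left to the table, which therefore has 81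
  entries.\<close>
proof (rule conn_certificate[where k = 4 and
      cs = "[(5, 0, 1, 3, [3, 4, 6, 2, 1, 0]), (6, 0, 2, 4, [4, 3, 5, 1, 2, 0])]" and
      ws = "[1637, 144, 162, 131, 176, 1636, 163, 2459, 130, 2474, 160, 2456, 1622, 1655, 129, 1654,
    128, 161, 179, 1639, 146, 1638, 3934, 178, 147, 1607, 1652, 1222, 32, 674, 643, 688, 1,
    675, 0, 33, 51, 672, 18, 2313, 2955, 50, 19, 640, 673, 691, 16, 34, 3, 48, 690, 35,
    2331, 2, 1125, 544, 1092, 1766, 2827, 513, 1093, 512, 545, 563, 1111, 530, 1110, 1143,
    562, 531, 3405, 2824, 1094, 528, 546, 515, 560, 1108, 547, 1095, 514]"])
qed (simp_all add: edges_4443_def certificate_simps del: net_add_mset)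

section \<open>Degrees in simple graphs and the Havel--Hakimi theorem\<close>

definition nbrs :: "'a set set \<Rightarrow> 'a \<Rightarrow> 'a set" where
  "nbrs E v = {u. {v, u} \<in> E}"

lemma simple_graph_finite_edges: "simple_graph V E \<Longrightarrow> finite E"
  by (rule finite_subset[of _ "Pow V"]) (auto simp: simple_graph_def)

lemma nbrs_sym: "u \<in> nbrs E v \<longleftrightarrow> v \<in> nbrs E u"
  by (simp add: nbrs_def insert_commute)

lemma nbrs_irrefl:
  assumes "simple_graph V E"
  shows "v \<notin> nbrs E v"
proof
  assume "v \<in> nbrs E v"
  then have "card {v, v} = 2" using assms unfolding nbrs_def simple_graph_def by blast
  then show False by simp
qed

lemma nbrs_subset: "simple_graph V E \<Longrightarrow> nbrs E v \<subseteq> V"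
  unfolding nbrs_def simple_graph_def by blast

lemma incident_edges_eq:
  assumes "simple_graph V E"
  shows "{e \<in> E. v \<in> e} = (\<lambda>u. {v, u}) ` nbrs E v"
proof -
  have "\<exists>u. e = {v, u}" if "e \<in> E" "v \<in> e" for e
  proof -
    have "card e = 2" using assms that(1) by (simp add: simple_graph_def)
    then obtain x y where "e = {x, y}" by (auto simp: card_2_iff)
    then show ?thesis using that(2) by (metis insert_commute insertE singletonD)
  qed
  then show ?thesis unfolding nbrs_def by blast
qed

lemma degree_eq_card_nbrs:
  assumes "simple_graph V E"
  shows "degree E v = card (nbrs E v)"
proof -
  have "inj_on (\<lambda>u. {v, u}) (nbrs E v)"
    by (auto simp: inj_on_def doubleton_eq_iff)
  then show ?thesis
    unfolding degree_def incident_edges_eq[OF assms] by (rule card_image)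
qed

lemma degree_less_card:
  assumes "simple_graph V E" "v \<in> V"
  shows "degree E v < card V"
proof -
  have "nbrs E v \<subset> V"
    using nbrs_subset[OF assms(1)] nbrs_irrefl[OF assms(1)] assms(2) by blast
  then show ?thesis
    using assms unfolding degree_eq_card_nbrs[OF assms(1)]
    by (intro psubset_card_mono) (auto simp: simple_graph_def)
qed

lemma degree_Un_disjoint:
  assumes "finite E" "finite F" "E \<inter> F = {}"
  shows "degree (E \<union> F) v = degree E v + degree F v"
proof -
  have "{e \<in> E \<union> F. v \<in> e} = {e \<in> E. v \<in> e} \<union> {e \<in> F. v \<in> e}" by blast
  then show ?thesis
    unfolding degree_def using assms by (simp add: card_Un_disjoint disjoint_iff)
qed

lemma degree_singleton: "degree {e} v = of_bool (v \<in> e)"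
proof -
  have "{f \<in> {e}. v \<in> f} = (if v \<in> e then {e} else {})" by auto
  then show ?thesis by (simp add: degree_def)
qed

lemma degree_insert:
  assumes "finite E" "e \<notin> E"
  shows "degree (insert e E) v = of_bool (v \<in> e) + degree E v"
  using degree_Un_disjoint[of "{e}" E v] assms by (simp add: degree_singleton)

lemma degree_remove:
  assumes "finite E" "e \<in> E"
  shows "degree E v = of_bool (v \<in> e) + degree (E - {e}) v"
  using degree_insert[of "E - {e}" e v] assms by (simp add: insert_absorb)

lemma handshake:
  assumes "simple_graph V E"
  shows "(\<Sum>v\<in>V. degree E v) = 2 * card E"
proof -
  have fin: "finite V" "finite E"
    using assms simple_graph_finite_edges by (auto simp: simple_graph_def)
  have "(\<Sum>v\<in>V. degree E v) = (\<Sum>v\<in>V. \<Sum>e\<in>{e. e \<in> E \<and> v \<in> e}. 1)"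
    by (simp add: degree_def)
  also have "\<dots> = (\<Sum>e\<in>E. \<Sum>v\<in>{v. v \<in> V \<and> v \<in> e}. 1)"
    using fin by (rule sum.swap_restrict)
  also have "\<dots> = (\<Sum>e\<in>E. 2)"
  proof (intro sum.cong refl)
    fix e assume "e \<in> E"
    then have "e \<subseteq> V" "card e = 2" using assms by (auto simp: simple_graph_def)
    moreover from this have "{v. v \<in> V \<and> v \<in> e} = e" by blast
    ultimately show "(\<Sum>v\<in>{v. v \<in> V \<and> v \<in> e}. 1) = (2::nat)" by simp
  qed
  finally show ?thesis by simp
qed

text \<open>As \<open>t\<close> misses the neighbour \<open>v\<close> of \<open>u\<close> without
  having smaller degree, it must have a neighbour \<open>w\<close> that \<open>u\<close> lacks.
  Exchanging \<open>{v, u}\<close>, \<open>{t, w}\<close> for \<open>{v, t}\<close>,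
  \<open>{u, w}\<close> then preserves all degrees.\<close>

lemma exists_switch_vertex:
  assumes G: "simple_graph V E" and u: "v \<in> nbrs E u" and t: "v \<notin> nbrs E t" "v \<noteq> t"
    and le: "degree E u \<le> degree E t"
  obtains w where "w \<in> nbrs E t" "w \<notin> nbrs E u" "w \<noteq> u"
proof -
  have fin: "finite (nbrs E x)" for x
    by (rule finite_subset[OF nbrs_subset[OF G]]) (use G in \<open>simp add: simple_graph_def\<close>)
  \<comment> \<open>If \<open>u\<close> and \<open>t\<close> are adjacent, each is a neighbour of
    the other. Leaving both out lowers the two cardinalities equally and keeps the degrees
    comparable.\<close>
  have "\<not> nbrs E t - {u} \<subseteq> nbrs E u - {t}"
  proof
    assume sub: "nbrs E t - {u} \<subseteq> nbrs E u - {t}"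
    have "nbrs E t - {u} \<subset> nbrs E u - {t}" using sub u t by blast
    then have "card (nbrs E t - {u}) < card (nbrs E u - {t})"
      using fin by (intro psubset_card_mono) auto
    moreover have "u \<in> nbrs E t \<longleftrightarrow> t \<in> nbrs E u" by (rule nbrs_sym)
    ultimately show False
      using le fin unfolding degree_eq_card_nbrs[OF G]
      by (cases "u \<in> nbrs E t") (simp_all add: card_Diff_singleton_if)
  qed
  then obtain w where "w \<in> nbrs E t" "w \<noteq> u" "w \<notin> nbrs E u \<or> w = t" by blast
  moreover have "w \<noteq> t" using calculation nbrs_irrefl[OF G] by blast
  ultimately show ?thesis using that by blast
qed

lemma switch_edges:
  assumes G: "simple_graph V E" and e: "{v, u} \<in> E" "{t, w} \<in> E" "{v, t} \<notin> E" "{u, w} \<notin> E"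
    and ne: "v \<noteq> t" "u \<noteq> w" "u \<noteq> t" "v \<noteq> w"
  defines "E' \<equiv> insert {v, t} (insert {u, w} (E - {{v, u}} - {{t, w}}))"
  shows "simple_graph V E'" "degree E' x = degree E x" "nbrs E' v = insert t (nbrs E v - {u})"
proof -
  have uv: "v \<noteq> u" "t \<noteq> w"
    using e nbrs_irrefl[OF G] unfolding nbrs_def by blast+
  have V: "v \<in> V" "u \<in> V" "t \<in> V" "w \<in> V"
    using e G unfolding simple_graph_def by blast+
  have "card {v, t} = 2" "card {u, w} = 2" using ne by simp_all
  then show "simple_graph V E'"
    using G V unfolding simple_graph_def E'_def by blast
  have fin: "finite E" by (rule simple_graph_finite_edges[OF G])
  have neq: "{v, t} \<noteq> {u, w}" "{t, w} \<noteq> {v, u}"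
    using ne uv by (auto simp: doubleton_eq_iff)
  have "degree E x = of_bool (x \<in> {v, u}) + (of_bool (x \<in> {t, w}) + degree (E - {{v, u}} - {{t, w}}) x)"
    using degree_remove[OF fin e(1), of x] degree_remove[of "E - {{v, u}}" "{t, w}" x] fin e neq
    by simp
  moreover have "degree E' x = of_bool (x \<in> {v, t}) + (of_bool (x \<in> {u, w}) + degree (E - {{v, u}} - {{t, w}}) x)"
    unfolding E'_def using fin e neq by (simp add: degree_insert)
  ultimately show "degree E' x = degree E x"
    using ne uv by (auto simp: of_bool_def)
  show "nbrs E' v = insert t (nbrs E v - {u})"
    using ne uv e unfolding nbrs_def E'_def by (auto simp: doubleton_eq_iff)
qed

text \<open>As long as \<open>v\<close> misses some \<open>t\<close> of \<open>T\<close>, equal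
  cardinalities give it a neighbour \<open>u\<close> outside \<open>T\<close>. The degree condition
  permits a switch that brings in \<open>t\<close> and drops \<open>u\<close>, so
  \<open>T - nbrs E v\<close> shrinks while all degrees stay fixed.\<close>

lemma realize_neighbourhood:
  assumes "simple_graph V E" "v \<in> V" "T \<subseteq> V - {v}" "card T = degree E v"
    and "\<And>t u. t \<in> T \<Longrightarrow> u \<in> V - {v} - T \<Longrightarrow> degree E u \<le> degree E t"
  shows "\<exists>E'. simple_graph V E' \<and> (\<forall>x. degree E' x = degree E x) \<and> nbrs E' v = T"
  using assms
proof (induction "card (T - nbrs E v)" arbitrary: E rule: less_induct)
  case less
  note G = less.prems(1)
  have finV: "finite V" using G by (simp add: simple_graph_def)
  have fin: "finite T" "finite (nbrs E v)"
    using finite_subset[OF less.prems(3)] finite_subset[OF nbrs_subset[OF G] finV] finV by simp_all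
  have card: "card (nbrs E v) = card T"
    using less.prems(4) degree_eq_card_nbrs[OF G] by simp
  show ?case
  proof (cases "T \<subseteq> nbrs E v")
    case True
    then have "T = nbrs E v" using card_subset_eq[OF fin(2) True] card by simp
    then show ?thesis using G by blast
  next
    case False
    then obtain t where t: "t \<in> T" "t \<notin> nbrs E v" by blast
    have "\<not> nbrs E v \<subseteq> T" using card_subset_eq[OF fin(1)] card False by blast
    then obtain u where u: "u \<in> nbrs E v" "u \<notin> T" by blast
    have uV: "u \<in> V - {v} - T" using u nbrs_subset[OF G] nbrs_irrefl[OF G] by blast
    have tv: "t \<noteq> v" using t(1) less.prems(3) by blast
    obtain w where w: "w \<in> nbrs E t" "w \<notin> nbrs E u" "w \<noteq> u"
    proof (rule exists_switch_vertex[OF G])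
      show "v \<in> nbrs E u" "v \<notin> nbrs E t" using u t by (simp_all add: nbrs_sym)
      show "degree E u \<le> degree E t" by (rule less.prems(5)[OF t(1) uV])
    qed (use tv in auto)
    have "w \<noteq> v" using w(1) t(2) nbrs_sym by metis
    let ?E = "insert {v, t} (insert {u, w} (E - {{v, u}} - {{t, w}}))"
    have e: "{v, u} \<in> E" "{t, w} \<in> E" "{v, t} \<notin> E" "{u, w} \<notin> E"
      using u(1) w(1,2) t(2) by (simp_all add: nbrs_def)
    have ne: "v \<noteq> t" "u \<noteq> w" "u \<noteq> t" "v \<noteq> w"
      using tv w(3) u(2) t(1) \<open>w \<noteq> v\<close> by auto
    note sw = switch_edges[OF G e ne]
    have "T - nbrs ?E v \<subset> T - nbrs E v"
      unfolding sw(3) using t u by blast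
    then have "card (T - nbrs ?E v) < card (T - nbrs E v)"
      using fin(1) by (intro psubset_card_mono) auto
    from less.hyps[OF this sw(1) less.prems(2,3)] less.prems(4,5)
    show ?thesis by (simp add: sw(2))
  qed
qed

text \<open>Multiplicities in \<open>mset_set V\<close> are at most one, so a part of it is again a
  set of vertices. This turns a choice of degrees into a choice of vertices.\<close>

lemma image_mset_set_splitE:
  assumes "finite V" "image_mset f (mset_set V) = M + N"
  obtains T where "T \<subseteq> V" "image_mset f (mset_set T) = N" "image_mset f (mset_set (V - T)) = M"
proof -
  obtain B C where BC: "mset_set V = B + C" "M = image_mset f B" "N = image_mset f C"
    using image_mset_eq_plusD[OF assms(2)] by auto
  define T where "T = set_mset C"
  have TV: "T \<subseteq> V"
    using assms(1) arg_cong[OF BC(1), of set_mset] by (auto simp: T_def)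
  then have fT: "finite T" using assms(1) by (rule finite_subset)
  have C: "C = mset_set T"
  proof (rule multiset_eqI)
    fix x
    have "count C x \<le> count (mset_set V) x" by (simp add: BC(1))
    also have "\<dots> \<le> 1" using assms(1) by (simp add: count_mset_set')
    finally have "count C x \<le> 1" .
    moreover have "1 \<le> count C x" if "x \<in># C" using that by (simp add: Suc_le_eq)
    ultimately have "count C x = of_bool (x \<in># C)"
      by (cases "x \<in># C") (auto simp: not_in_iff intro: antisym)
    then show "count C x = count (mset_set T) x"
      using fT by (simp add: T_def count_mset_set')
  qed
  have "B = mset_set V - mset_set T" by (simp add: BC(1) C)
  also have "\<dots> = mset_set (V - T)" using assms(1) TV by (simp add: mset_set_Diff)
  finally show ?thesis using that[OF TV] BC(2,3) C by simp
qed

lemma image_mset_set_addE: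
  assumes "finite V" "image_mset f (mset_set V) = add_mset x M"
  obtains v where "v \<in> V" "f v = x" "image_mset f (mset_set (V - {v})) = M"
proof -
  obtain B v where B: "mset_set V = add_mset v B" "f v = x" "image_mset f B = M"
    using msed_map_invR[OF assms(2)] by auto
  have "v \<in> V" using assms(1) arg_cong[OF B(1), of set_mset] by auto
  moreover from this have "mset_set (V - {v}) = B"
    using assms(1) B(1) by (simp add: mset_set.remove)
  ultimately show ?thesis using that B by simp
qed

section \<open>Degree multisets and the Havel--Hakimi reduction\<close>

definition degree_mset :: "nat set \<Rightarrow> nat set set \<Rightarrow> nat multiset" where
  "degree_mset V E = image_mset (degree E) (mset_set V)"

definition graphic_mset :: "nat multiset \<Rightarrow> bool" where
  "graphic_mset M \<longleftrightarrow> (\<exists>V E. simple_graph V E \<and> degree_mset V E = M)"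

definition realizable :: "nat multiset \<Rightarrow> bool" where
  "realizable M \<longleftrightarrow> (\<exists>V E. simple_graph V E \<and> conn V (mset_set E) \<and> degree_mset V E = M)"

lemma even_sum_graphic_mset:
  assumes "graphic_mset M"
  shows "even (sum_mset M)"
proof -
  obtain V E where "simple_graph V E" "degree_mset V E = M"
    using assms by (auto simp: graphic_mset_def)
  then show ?thesis
    using handshake[of V E] by (auto simp: degree_mset_def sum_unfold_sum_mset)
qed

lemma graphic_mset_less_size:
  assumes "graphic_mset M" "d \<in># M"
  shows "d < size M"
proof -
  obtain V E where "simple_graph V E" "degree_mset V E = M"
    using assms by (auto simp: graphic_mset_def)
  then show ?thesis
    using degree_less_card[of V E] assms(2)
    by (auto simp: degree_mset_def simple_graph_def)
qed

lemma degree_delete_vertex: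
  assumes "simple_graph V E" "u \<noteq> v"
  shows "degree E u = degree {e \<in> E. v \<notin> e} u + of_bool (u \<in> nbrs E v)"
proof -
  have fin: "finite E" by (rule simple_graph_finite_edges[OF assms(1)])
  have "{e \<in> {e \<in> E. v \<in> e}. u \<in> e} = (if u \<in> nbrs E v then {{v, u}} else {})"
    unfolding incident_edges_eq[OF assms(1)] using assms(2) by auto
  then have "degree {e \<in> E. v \<in> e} u = of_bool (u \<in> nbrs E v)"
    by (simp add: degree_def)
  moreover have "degree E u = degree ({e \<in> E. v \<notin> e} \<union> {e \<in> E. v \<in> e}) u"
    by (rule arg_cong[where f = "\<lambda>E. degree E u"]) blast
  moreover have "\<dots> = degree {e \<in> E. v \<notin> e} u + degree {e \<in> E. v \<in> e} u"
    using fin by (intro degree_Un_disjoint) auto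
  ultimately show ?thesis by simp
qed

text \<open>The deleted vertex may have any degree \<open>d\<close>, in particular the minimum. Once
  its neighbourhood has been switched onto the vertices carrying \<open>N\<close>, its deletion
  lowers exactly those degrees.\<close>

lemma Havel_Hakimi:
  assumes "graphic_mset (add_mset d (M + N))" "size N = d"
    and "\<And>x y. x \<in># N \<Longrightarrow> y \<in># M \<Longrightarrow> y \<le> x"
  shows "graphic_mset (M + image_mset (\<lambda>x. x - 1) N)"
proof -
  obtain V :: "nat set" and E where G: "simple_graph V E" and deg: "image_mset (degree E) (mset_set V) = add_mset d (M + N)"
    using assms(1) unfolding graphic_mset_def degree_mset_def by blast
  have finV: "finite V" using G by (simp add: simple_graph_def)
  obtain v where v: "v \<in> V" "degree E v = d" "image_mset (degree E) (mset_set (V - {v})) = M + N"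
    using image_mset_set_addE[OF finV deg] .
  obtain T where T: "T \<subseteq> V - {v}" "image_mset (degree E) (mset_set T) = N"
      "image_mset (degree E) (mset_set (V - {v} - T)) = M"
    by (rule image_mset_set_splitE[OF _ v(3)]) (use finV in simp_all)
  have finT: "finite T" using finite_subset[OF T(1)] finV by simp
  have "card T = degree E v"
    using arg_cong[OF T(2), of size] assms(2) v(2) by simp
  moreover have "degree E u \<le> degree E t" if "t \<in> T" "u \<in> V - {v} - T" for t u
  proof (rule assms(3))
    show "degree E t \<in># N" "degree E u \<in># M"
      using that finT finV by (simp_all flip: T(2,3))
  qed
  ultimately obtain E' where E': "simple_graph V E'" "\<And>x. degree E' x = degree E x" "nbrs E' v = T"
    using realize_neighbourhood[OF G v(1) T(1)] by blast
  define F where "F = {e \<in> E'. v \<notin> e}"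
  have deg: "degree F u = degree E u - of_bool (u \<in> T)" if "u \<noteq> v" for u
    using degree_delete_vertex[OF E'(1) that] E'(2,3) unfolding F_def by simp
  have "simple_graph (V - {v}) F"
    using E'(1) unfolding F_def simple_graph_def by blast
  moreover have "degree_mset (V - {v}) F = M + image_mset (\<lambda>x. x - 1) N"
  proof -
    have "V - {v} = (V - {v} - T) \<union> T" using T(1) by blast
    then have "mset_set (V - {v}) = mset_set (V - {v} - T) + mset_set T"
      using finV finT by (metis Diff_disjoint Int_commute finite_Diff mset_set_Union)
    moreover have "image_mset (degree F) (mset_set (V - {v} - T)) = M"
      unfolding T(3)[symmetric] using finV by (intro image_mset_cong) (auto simp: deg)
    moreover have "image_mset (degree F) (mset_set T) = image_mset (\<lambda>x. x - 1) N"
      unfolding T(2)[symmetric] image_mset.compositionality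
    proof (intro image_mset_cong)
      fix u assume "u \<in># mset_set T"
      then have "u \<in> T" "u \<noteq> v" using finT T(1) by auto
      then show "degree F u = ((\<lambda>x. x - 1) \<circ> degree E) u" by (simp add: deg)
    qed
    ultimately show ?thesis by (simp add: degree_mset_def)
  qed
  ultimately show ?thesis unfolding graphic_mset_def by blast
qed

section \<open>Constructions of connected realizations\<close>

text \<open>Used with \<open>f = ends\<close>: a multiset of arcs that covers each edge exactly once
  becomes a choice \<open>g\<close> of one arc per edge, that is, an orientation.\<close>

lemma image_mset_eq_mset_setE:
  assumes "finite E" "image_mset f D = mset_set E"
  shows "\<exists>g. D = image_mset g (mset_set E) \<and> (\<forall>e\<in>E. f (g e) = e)"
  using assms
proof (induction E arbitrary: D rule: finite_induct)
  case (insert e E)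
  then have "image_mset f D = add_mset e (mset_set E)" by simp
  then obtain D' d where D: "D = add_mset d D'" "f d = e" "image_mset f D' = mset_set E"
    using msed_map_invR by metis
  obtain g where g: "D' = image_mset g (mset_set E)" "\<forall>e\<in>E. f (g e) = e"
    using insert.IH[OF D(3)] by auto
  have "image_mset (g(e := d)) (mset_set E) = image_mset g (mset_set E)"
    using insert.hyps by (intro image_mset_cong) auto
  then have "D = image_mset (g(e := d)) (mset_set (insert e E))"
    using insert.hyps by (simp add: D(1) g(1) fun_upd_same del: fun_upd_apply)
  moreover have "\<forall>e'\<in>insert e E. f ((g(e := d)) e') = e'"
    using D(2) g(2) by simp
  ultimately show ?case by blast
qed simp

lemma Z3_connected_if_conn:
  assumes G: "simple_graph V E" and conn: "conn V (mset_set E)"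
  shows "Z3_connected V E"
  unfolding Z3_connected_def
proof (intro allI impI)
  fix b :: "'a \<Rightarrow> Z3"
  assume b: "zero_sum V b"
  have fin: "finite E" "finite V"
    using G simple_graph_finite_edges[OF G] by (simp_all add: simple_graph_def)
  \<comment> \<open>\<open>zero_sum\<close> does not restrict \<open>b\<close> off \<open>V\<close>,
    so it is cut off there.\<close>
  have "demand V (\<lambda>v. if v \<in> V then b v else 0)"
    using b fin(2) by (simp add: demand_def zero_sum_def)
  then have "flows (mset_set E) (\<lambda>v. if v \<in> V then b v else 0)"
    using conn by (simp add: conn_def)
  then obtain D where D: "image_mset ends D = mset_set E" "(\<lambda>v. if v \<in> V then b v else 0) = net D"
    by (auto simp: flows_def)
  obtain g where g: "D = image_mset g (mset_set E)" "\<forall>e\<in>E. ends (g e) = e"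
    using image_mset_eq_mset_setE[OF fin(1) D(1)] by auto
  let ?tail = "fst \<circ> g" and ?head = "snd \<circ> g"
  have "orientation E ?tail ?head"
    using g(2) by (simp add: orientation_def ends_def)
  \<comment> \<open>The directions already account for the signs, so the constant map 1
    serves.\<close>
  moreover have "boundary E ?tail ?head (\<lambda>_. 1) v = b v" if "v \<in> V" for v
  proof -
    have "b v = net D v" using fun_cong[OF D(2), of v] that by simp
    also have "\<dots> = (\<Sum>e\<in>E. unit_flow (?tail e) (?head e) v)"
      unfolding g(1) net_def by (simp add: sum_unfold_sum_mset case_prod_beta image_mset.compositionality comp_def)
    also have "\<dots> = (\<Sum>e\<in>E. if ?tail e = v then 1 else 0) - (\<Sum>e\<in>E. if ?head e = v then 1 else 0)"
      unfolding sum_subtractf[symmetric] by (intro sum.cong) (auto simp: unit_flow_def)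
    also have "\<dots> = boundary E ?tail ?head (\<lambda>_. 1) v"
      unfolding boundary_def sum.inter_filter[OF fin(1)] ..
    finally show ?thesis ..
  qed
  ultimately show "\<exists>tail head f. orientation E tail head \<and> (\<forall>e\<in>E. f e \<noteq> 0) \<and>
      (\<forall>v\<in>V. boundary E tail head f v = b v)"
    by (intro exI[of _ ?tail] exI[of _ ?head] exI[of _ "\<lambda>_. 1"]) simp
qed

text \<open>Increasing pairs have different endpoint sets whenever they differ. Hence simplicity and
  all degrees can be computed from the list.\<close>

lemma realizable_edge_list:
  assumes conn: "conn {..<n} (mset (map ends L))"
    and L: "list_all (\<lambda>(x, y). x < y \<and> y < n) L" "distinct L"
  shows "realizable (mset (map (\<lambda>v. length (filter (incident v) L)) [0..<n]))"
proof -
  have "inj_on ends (set L)"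
  proof (rule inj_onI)
    fix d d' assume d: "d \<in> set L" "d' \<in> set L" "ends d = ends d'"
    have "fst d < snd d" "fst d' < snd d'"
      using d(1,2) L(1) by (auto simp: list_all_iff)
    then show "d = d'" using d(3) by (auto simp: ends_def doubleton_eq_iff prod_eq_iff)
  qed
  then have d: "distinct (map ends L)" using L(2) by (simp add: distinct_map)
  let ?E = "set (map ends L)"
  have "simple_graph {..<n} ?E"
    using L(1) by (auto simp: simple_graph_def list_all_iff ends_def)
  moreover have "conn {..<n} (mset_set ?E)"
    using conn mset_set_set[OF d] by simp
  moreover have deg: "degree ?E v = length (filter (incident v) L)" for v
  proof -
    have "{e \<in> ?E. v \<in> e} = set (filter (\<lambda>e. v \<in> e) (map ends L))" by simp
    then have "degree ?E v = length (filter (\<lambda>e. v \<in> e) (map ends L))"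
      unfolding degree_def using d by (metis distinct_card distinct_filter)
    also have "\<dots> = length (filter (incident v) L)"
      unfolding filter_map length_map
      by (intro arg_cong[where f = length] filter_cong) (auto simp: incident_def ends_def)
    finally show ?thesis .
  qed
  have "degree_mset {..<n} ?E = mset (map (\<lambda>v. length (filter (incident v) L)) [0..<n])"
    unfolding degree_mset_def deg by (simp add: lessThan_atLeast0 flip: mset_upt)
  ultimately show ?thesis unfolding realizable_def by blast
qed

text \<open>The new vertex is joined to any set of vertices whose degrees form \<open>N\<close>. Two
  of its edges already secure connectivity by \<open>conn_attach\<close>; the others come from
  \<open>conn_mono\<close>.\<close>

lemma realizable_attach:
  assumes "realizable (M + N)" "2 \<le> size N"
  shows "realizable (add_mset (size N) (M + image_mset Suc N))"
proof -
  obtain V :: "nat set" and E where G: "simple_graph V E" and C: "conn V (mset_set E)"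
    and deg: "image_mset (degree E) (mset_set V) = M + N"
    using assms(1) unfolding realizable_def degree_mset_def by blast
  have finV: "finite V" and finE: "finite E"
    using G simple_graph_finite_edges[OF G] by (simp_all add: simple_graph_def)
  obtain T where T: "T \<subseteq> V" "image_mset (degree E) (mset_set T) = N"
      "image_mset (degree E) (mset_set (V - T)) = M"
    by (rule image_mset_set_splitE[OF finV deg])
  have finT: "finite T" by (rule finite_subset[OF T(1) finV])
  have cardT: "card T = size N" using arg_cong[OF T(2), of size] by simp
  then obtain T' where "T' \<subseteq> T" "card T' = 2" using assms(2) obtain_subset_with_card_n by metis
  then obtain x y where xy: "x \<in> T" "y \<in> T" "x \<noteq> y" by (auto simp: card_2_iff)
  obtain v where v: "v \<notin> V" using ex_new_if_finite[OF infinite_UNIV_nat finV] by blast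
  define F where "F = (\<lambda>t. {v, t}) ` T"
  have finF: "finite F" using finT by (simp add: F_def)
  have EV: "e \<subseteq> V" if "e \<in> E" for e using G that by (simp add: simple_graph_def)
  have disj: "E \<inter> F = {}" using EV v by (auto simp: F_def)
  have degF: "degree F u = of_bool (u \<in> T)" if "u \<noteq> v" for u
  proof -
    have "{e \<in> F. u \<in> e} = (if u \<in> T then {{v, u}} else {})"
      using that by (auto simp: F_def)
    then show ?thesis by (simp add: degree_def)
  qed
  have "{e \<in> F. v \<in> e} = F" by (auto simp: F_def)
  moreover have "inj_on (\<lambda>t. {v, t}) T" by (auto simp: inj_on_def doubleton_eq_iff)
  ultimately have degFv: "degree F v = size N"
    by (simp add: degree_def F_def card_image cardT)
  have "{e \<in> E. v \<in> e} = {}" using EV v by blast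
  then have degEv: "degree E v = 0" by (metis card.empty degree_def)
  have deg': "degree (E \<union> F) u = degree E u + degree F u" for u
    by (rule degree_Un_disjoint[OF finE finF disj])
  have simple: "simple_graph (insert v V) (E \<union> F)"
  proof -
    have "card {v, t} = 2" "{v, t} \<subseteq> insert v V" if "t \<in> T" for t
    proof -
      have "v \<noteq> t" using that T(1) v by auto
      then show "card {v, t} = 2" "{v, t} \<subseteq> insert v V" using that T(1) by auto
    qed
    then show ?thesis using G unfolding simple_graph_def F_def by auto
  qed
  moreover have "conn (insert v V) (mset_set (E \<union> F))"
  proof (rule conn_mono)
    show "conn (insert v V) (add_mset {v, x} (add_mset {v, y} (mset_set E)))"
      using xy T(1) v by (intro conn_attach C) auto
    have "{v, x} \<notin> E" "{v, y} \<notin> E" "{v, x} \<noteq> {v, y}"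
      using EV v xy by (auto simp: doubleton_eq_iff)
    then have "add_mset {v, x} (add_mset {v, y} (mset_set E)) = mset_set (insert {v, x} (insert {v, y} E))"
      using finE by simp
    also have "\<dots> \<subseteq># mset_set (E \<union> F)"
      using xy finE finF by (intro subset_imp_msubset_mset_set) (auto simp: F_def)
    finally show "add_mset {v, x} (add_mset {v, y} (mset_set E)) \<subseteq># mset_set (E \<union> F)" .
    have "\<exists>x\<in>insert v V. \<exists>y\<in>insert v V. e = {x, y}" if "e \<in> E \<union> F" for e
    proof -
      have "card e = 2" "e \<subseteq> insert v V" using simple that unfolding simple_graph_def by blast+
      then show ?thesis by (auto simp: card_2_iff)
    qed
    then show "\<forall>e\<in>#mset_set (E \<union> F). \<exists>x\<in>insert v V. \<exists>y\<in>insert v V. e = {x, y}"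
      using finE finF by simp
  qed
  moreover have "degree_mset (insert v V) (E \<union> F) = add_mset (size N) (M + image_mset Suc N)"
  proof -
    have "mset_set V = mset_set (V - T) + mset_set T"
    proof -
      have "(V - T) \<union> T = V" "(V - T) \<inter> T = {}" using T(1) by blast+
      then show ?thesis using mset_set_Union[of "V - T" T] finV finT by simp
    qed
    moreover have "image_mset (degree (E \<union> F)) (mset_set (V - T)) = M"
      unfolding T(3)[symmetric]
    proof (intro image_mset_cong)
      fix u assume "u \<in># mset_set (V - T)"
      then have "u \<notin> T" "u \<noteq> v" using finV v by auto
      then show "degree (E \<union> F) u = degree E u" by (simp add: deg' degF)
    qed
    moreover have "image_mset (degree (E \<union> F)) (mset_set T) = image_mset Suc N"
      unfolding T(2)[symmetric] image_mset.compositionality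
    proof (intro image_mset_cong)
      fix u assume "u \<in># mset_set T"
      then have "u \<in> T" "u \<noteq> v" using finT T(1) v by auto
      then show "degree (E \<union> F) u = (Suc \<circ> degree E) u" by (simp add: deg' degF)
    qed
    ultimately show ?thesis
      using finV v by (simp add: degree_mset_def deg' degEv degFv)
  qed
  ultimately show ?thesis unfolding realizable_def by blast
qed

text \<open>Coinciding inner ends create no parallel edges because the four spokes start at
  different rim vertices. An inner vertex gains one for each spoke that ends there.\<close>

lemma surround_graph:
  fixes V :: "nat set"
  assumes G: "simple_graph V E" and C: "conn V (mset_set E)" and abcd: "{a, b, c, d} \<subseteq> V"
  shows "realizable ({#3, 3, 3, 3#} + image_mset
      (\<lambda>x. degree E x + of_bool (x = a) + of_bool (x = b) + of_bool (x = c) + of_bool (x = d)) (mset_set V))"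
proof -
  have finV: "finite V" and finE: "finite E"
    using G simple_graph_finite_edges[OF G] by (simp_all add: simple_graph_def)
  have new: "\<exists>x. x \<notin> A" if "finite A" for A :: "nat set"
    using ex_new_if_finite[OF infinite_UNIV_nat that] .
  obtain p where p: "p \<notin> V" using new[OF finV] by blast
  obtain q where q: "q \<notin> insert p V" using new[of "insert p V"] finV by auto
  obtain r where r: "r \<notin> insert q (insert p V)" using new[of "insert q (insert p V)"] finV by auto
  obtain s where s: "s \<notin> insert r (insert q (insert p V))"
    using new[of "insert r (insert q (insert p V))"] finV by auto
  have ne: "p \<noteq> q" "p \<noteq> r" "p \<noteq> s" "q \<noteq> r" "q \<noteq> s" "r \<noteq> s"
    using q r s by auto
  have ne': "x \<noteq> p" "x \<noteq> q" "x \<noteq> r" "x \<noteq> s" if "x \<in> V" for x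
    using that p q r s by auto
  have abcd': "a \<in> V" "b \<in> V" "c \<in> V" "d \<in> V" using abcd by auto
  note neqs = ne ne[symmetric] ne'[OF abcd'(1)] ne'[OF abcd'(2)] ne'[OF abcd'(3)] ne'[OF abcd'(4)]
    ne'[OF abcd'(1), symmetric] ne'[OF abcd'(2), symmetric] ne'[OF abcd'(3), symmetric]
    ne'[OF abcd'(4), symmetric]
  define F where "F = {{p, q}, {q, r}, {r, s}, {s, p}, {p, a}, {q, b}, {r, c}, {s, d}}"
  have F: "mset_set F = wheel_edges p q r s a b c d"
    unfolding F_def wheel_edges_def by (simp add: doubleton_eq_iff neqs)
  have finF: "finite F" by (simp add: F_def)
  have disj: "F \<inter> E = {}"
  proof -
    have "e \<subseteq> V" if "e \<in> E" for e using G that by (simp add: simple_graph_def)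
    moreover have "\<not> e \<subseteq> V" if "e \<in> F" for e
      using that p q r s by (auto simp: F_def)
    ultimately show ?thesis by blast
  qed
  let ?V = "{p, q, r, s} \<union> V"
  have "simple_graph ?V (F \<union> E)"
  proof -
    have "\<forall>e\<in>F. e \<subseteq> ?V \<and> card e = 2"
      unfolding F_def using abcd' by (simp add: neqs)
    moreover have "\<forall>e\<in>E. e \<subseteq> ?V \<and> card e = 2" using G unfolding simple_graph_def by blast
    ultimately show ?thesis using finV unfolding simple_graph_def by blast
  qed
  moreover have "conn ?V (mset_set (F \<union> E))"
    unfolding mset_set_Union[OF finF finE disj] F
    using p q r s by (intro conn_surround C abcd) auto
  moreover have deg: "degree (F \<union> E) x = degree F x + degree E x" for x
    by (rule degree_Un_disjoint[OF finF finE disj])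
  have degF: "degree F x = size {#e \<in># wheel_edges p q r s a b c d. x \<in> e#}" for x
    using finF unfolding F[symmetric] degree_def by (simp add: filter_mset_mset_set)
  have degF3: "degree F p = 3" "degree F q = 3" "degree F r = 3" "degree F s = 3"
    unfolding degF wheel_edges_def by (simp_all add: neqs)
  have degFV: "degree F x = of_bool (x = a) + of_bool (x = b) + of_bool (x = c) + of_bool (x = d)"
    if "x \<in> V" for x
    unfolding degF wheel_edges_def using ne'[OF that] by simp
  have degE: "degree E x = 0" if "x \<notin> V" for x
  proof -
    have "{e \<in> E. x \<in> e} = {}" using G that unfolding simple_graph_def by blast
    then show ?thesis by (metis card.empty degree_def)
  qed
  have "degree_mset ?V (F \<union> E) = {#3, 3, 3, 3#} + image_mset
      (\<lambda>x. degree E x + of_bool (x = a) + of_bool (x = b) + of_bool (x = c) + of_bool (x = d)) (mset_set V)"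
  proof -
    have pqrs: "p \<notin> V" "q \<notin> V" "r \<notin> V" "s \<notin> V" using p q r s by auto
    have "image_mset (degree (F \<union> E)) (mset_set V) = image_mset
        (\<lambda>x. degree E x + of_bool (x = a) + of_bool (x = b) + of_bool (x = c) + of_bool (x = d)) (mset_set V)"
      using finV by (intro image_mset_cong) (simp add: deg degFV)
    then show ?thesis
      using finV pqrs ne by (simp add: degree_mset_def deg degF3 degE)
  qed
  ultimately show ?thesis unfolding realizable_def by metis
qed


lemma realizable_surround_distinct:
  assumes "realizable (M + {#i, j, k, l#})"
  shows "realizable (M + {#i + 1, j + 1, k + 1, l + 1, 3, 3, 3, 3#})"
proof -
  obtain V :: "nat set" and E where G: "simple_graph V E" and C: "conn V (mset_set E)"
    and deg: "image_mset (degree E) (mset_set V) = add_mset i (add_mset j (add_mset k (add_mset l M)))"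
    using assms unfolding realizable_def degree_mset_def by auto
  have finV: "finite V" using G by (simp add: simple_graph_def)
  obtain a where a: "a \<in> V" "degree E a = i"
      "image_mset (degree E) (mset_set (V - {a})) = add_mset j (add_mset k (add_mset l M))"
    by (rule image_mset_set_addE[OF finV deg])
  obtain b where b: "b \<in> V - {a}" "degree E b = j"
      "image_mset (degree E) (mset_set (V - {a} - {b})) = add_mset k (add_mset l M)"
    by (rule image_mset_set_addE[OF _ a(3)]) (use finV in auto)
  obtain c where c: "c \<in> V - {a} - {b}" "degree E c = k"
      "image_mset (degree E) (mset_set (V - {a} - {b} - {c})) = add_mset l M"
    by (rule image_mset_set_addE[OF _ b(3)]) (use finV in auto)
  obtain d where d: "d \<in> V - {a} - {b} - {c}" "degree E d = l"
      "image_mset (degree E) (mset_set (V - {a} - {b} - {c} - {d})) = M"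
    by (rule image_mset_set_addE[OF _ c(3)]) (use finV in auto)
  let ?R = "V - {a} - {b} - {c} - {d}"
  have V: "mset_set V = {#a, b, c, d#} + mset_set ?R"
    using a(1) b(1) c(1) d(1) finV by (simp add: mset_set.remove[of _ a] mset_set.remove[of _ b]
        mset_set.remove[of _ c] mset_set.remove[of _ d])
  have "image_mset (\<lambda>x. degree E x + of_bool (x = a) + of_bool (x = b) + of_bool (x = c) +
      of_bool (x = d)) (mset_set ?R) = M"
    unfolding d(3)[symmetric] using finV by (intro image_mset_cong) simp
  then have "image_mset (\<lambda>x. degree E x + of_bool (x = a) + of_bool (x = b) + of_bool (x = c) +
      of_bool (x = d)) (mset_set V) = M + {#i + 1, j + 1, k + 1, l + 1#}"
    unfolding V using a b c d by simp
  with surround_graph[OF G C, of a b c d] a(1) b(1) c(1) d(1) show ?thesis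
    by (simp add: add_mset_commute)
qed

text \<open>Two spokes share an inner end, which gains two. This is how a 3 becomes the 5 of
  (5,4^a,3^5).\<close>

lemma realizable_surround_repeated:
  assumes "realizable (M + {#i, j, k#})"
  shows "realizable (M + {#i + 2, j + 1, k + 1, 3, 3, 3, 3#})"
proof -
  obtain V :: "nat set" and E where G: "simple_graph V E" and C: "conn V (mset_set E)"
    and deg: "image_mset (degree E) (mset_set V) = add_mset i (add_mset j (add_mset k M))"
    using assms unfolding realizable_def degree_mset_def by auto
  have finV: "finite V" using G by (simp add: simple_graph_def)
  obtain a where a: "a \<in> V" "degree E a = i"
      "image_mset (degree E) (mset_set (V - {a})) = add_mset j (add_mset k M)"
    by (rule image_mset_set_addE[OF finV deg])
  obtain b where b: "b \<in> V - {a}" "degree E b = j"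
      "image_mset (degree E) (mset_set (V - {a} - {b})) = add_mset k M"
    by (rule image_mset_set_addE[OF _ a(3)]) (use finV in auto)
  obtain c where c: "c \<in> V - {a} - {b}" "degree E c = k"
      "image_mset (degree E) (mset_set (V - {a} - {b} - {c})) = M"
    by (rule image_mset_set_addE[OF _ b(3)]) (use finV in auto)
  let ?R = "V - {a} - {b} - {c}"
  have V: "mset_set V = {#a, b, c#} + mset_set ?R"
    using a(1) b(1) c(1) finV by (simp add: mset_set.remove[of _ a] mset_set.remove[of _ b]
        mset_set.remove[of _ c])
  have "image_mset (\<lambda>x. degree E x + of_bool (x = a) + of_bool (x = a) + of_bool (x = b) +
      of_bool (x = c)) (mset_set ?R) = M"
    unfolding c(3)[symmetric] using finV by (intro image_mset_cong) simp
  then have "image_mset (\<lambda>x. degree E x + of_bool (x = a) + of_bool (x = a) + of_bool (x = b) +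
      of_bool (x = c)) (mset_set V) = M + {#i + 2, j + 1, k + 1#}"
    unfolding V using a b c by simp
  with surround_graph[OF G C, of a a b c] a(1) b(1) c(1) show ?thesis
    by (simp add: add_mset_commute)
qed

section \<open>The special degree sequences\<close>

definition wheel_list :: "(nat \<times> nat) list" where
  "wheel_list = [(1, 2), (2, 3), (3, 4), (1, 4), (0, 1), (0, 2), (0, 3), (0, 4)]"

text \<open>A single vertex is trivially connected, so surrounding it yields the wheel, with hub 0.
  The list \<open>L\<close> leaves room for chords of the rim.\<close>

lemma conn_wheel:
  assumes "list_all (\<lambda>(x, y). x < 5 \<and> y < 5) L"
  shows "conn {..<5} (mset (map ends (wheel_list @ L)))"
proof (rule conn_mono)
  have "conn ({1, 2, 3, 4} \<union> {0::nat}) (wheel_edges 1 2 3 4 0 0 0 0 + {#})"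
    by (rule conn_surround[OF conn_singleton]) auto
  moreover have "{1, 2, 3, 4} \<union> {0} = {..<5::nat}" by auto
  ultimately show "conn {..<5} (mset (map ends wheel_list))"
    by (simp add: wheel_edges_def wheel_list_def add_mset_commute insert_commute)
  show "mset (map ends wheel_list) \<subseteq># mset (map ends (wheel_list @ L))" by simp
  have "\<exists>x\<in>{..<5}. \<exists>y\<in>{..<5}. ends d = {x, y}" if "d \<in> set (wheel_list @ L)" for d
  proof -
    have "list_all (\<lambda>(x, y). x < 5 \<and> y < 5) (wheel_list @ L)"
      using assms by (simp add: wheel_list_def)
    then have "case d of (x, y) \<Rightarrow> x < 5 \<and> y < 5" using that unfolding list_all_iff by blast
    then have "fst d < 5 \<and> snd d < 5" by (simp add: case_prod_beta)
    then show ?thesis unfolding ends_def by (metis lessThan_iff)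
  qed
  then show "\<forall>e\<in>#mset (map ends (wheel_list @ L)). \<exists>x\<in>{..<5}. \<exists>y\<in>{..<5}. e = {x, y}"
    unfolding set_mset_mset set_map by blast
qed

lemma upt_5: "[0..<5] = [0, 1, 2, 3, 4]"
  by (simp add: upt_rec eval_nat_numeral)

text \<open>These are the wheel, the wheel with one chord (K_5 minus an edge), and K_5.\<close>

lemma realizable_order_5:
  "realizable {#4, 3, 3, 3, 3#}" "realizable {#4, 4, 4, 3, 3#}" "realizable {#4, 4, 4, 4, 4#}"
  using realizable_edge_list[OF conn_wheel[of "[]"]] realizable_edge_list[OF conn_wheel[of "[(1, 3)]"]]
    realizable_edge_list[OF conn_wheel[of "[(1, 3), (2, 4)]"]]
  by (simp_all add: wheel_list_def upt_5 incident_def add_mset_commute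
      numeral_2_eq_2[symmetric])

lemma realizable_certified:
  "realizable {#4, 4, 3, 3, 3, 3#}" "realizable {#5, 4, 3, 3, 3, 3, 3#}" "realizable {#5, 4, 4, 3, 3, 3, 3, 3#}"
  "realizable {#4, 4, 4, 4, 3, 3, 3, 3#}" "realizable {#4, 4, 4, 3, 3, 3, 3#}"
  using realizable_edge_list[OF conn_4433] realizable_edge_list[OF conn_543] realizable_edge_list[OF conn_5443]
    realizable_edge_list[OF conn_44443] realizable_edge_list[OF conn_4443]
  by (simp_all add: edges_4433_def edges_543_def edges_5443_def edges_44443_def edges_4443_def
      upt_6_7_8 incident_def numeral_2_eq_2[symmetric])

text \<open>Surrounding with spokes at the four 3s makes them 4s and supplies four new 3s, so
  \<open>a\<close> advances by four. The starting values 1 to 4 are the wheel and three certified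
  graphs.\<close>

lemma realizable_4s_3333:
  assumes "1 \<le> a"
  shows "realizable (replicate_mset a 4 + {#3, 3, 3, 3#})"
  using assms
proof (induction a rule: less_induct)
  case (less a)
  show ?case
  proof (cases "a \<le> 4")
    case True
    then have "a = 1 \<or> a = 2 \<or> a = 3 \<or> a = 4" using less.prems by linarith
    then show ?thesis
      using realizable_order_5(1) realizable_certified by (elim disjE) (simp_all add: numeral_eq_Suc add_mset_commute)
  next
    case False
    define c where "c = a - 4"
    have a: "a = c + 4" "1 \<le> c" using False by (simp_all add: c_def)
    then have "realizable (replicate_mset c 4 + {#3, 3, 3, 3#})" using less.IH[of c] by simp
    from realizable_surround_distinct[OF this] show ?thesis
      by (simp add: a numeral_eq_Suc add_mset_commute)
  qed
qed

text \<open>A new vertex is attached to the hub and one 3; a second is attached to a vertex with the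
  hub's new degree, another 3 and a vertex of degree 2. The intermediate degree 2 is harmless, as
  only connectivity is carried along.\<close>

lemma realizable_extend_hub:
  assumes "realizable (M + {#d, 3, 3#})"
  shows "realizable (M + {#d + 2, 4, 4, 3, 3#})"
proof -
  have "realizable ((M + {#3#}) + {#d, 3#})" using assms by (simp add: add_mset_commute)
  from realizable_attach[OF this] have "realizable ((M + {#4#}) + {#d + 1, 3, 2#})"
    by (simp add: add_mset_commute numeral_eq_Suc)
  from realizable_attach[OF this] show ?thesis
    by (simp add: add_mset_commute numeral_eq_Suc)
qed

text \<open>For \<open>a \<ge> 3\<close> three 3s of (4^(a-2),3^4) become 5, 4, 4, and the
  surrounding cycle restores the 3s. That family requires at least one 4, so \<open>a = 1\<close>
  and \<open>a = 2\<close> rest on certificates.\<close>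

lemma realizable_54s_33333:
  assumes "1 \<le> a"
  shows "realizable (replicate_mset a 4 + {#5, 3, 3, 3, 3, 3#})"
proof -
  consider "a = 1 \<or> a = 2" | "3 \<le> a" using assms by linarith
  then show ?thesis
  proof cases
    case 1
    then show ?thesis
      using realizable_certified by (elim disjE) (simp_all add: numeral_eq_Suc add_mset_commute)
  next
    case 2
    define c where "c = a - 2"
    have a: "a = c + 2" "1 \<le> c" using 2 by (simp_all add: c_def)
    then have "realizable ((replicate_mset c 4 + {#3#}) + {#3, 3, 3#})"
      using realizable_4s_3333[of c] by (simp add: add_mset_commute)
    from realizable_surround_repeated[OF this] show ?thesis
      by (simp add: a numeral_eq_Suc add_mset_commute)
  qed
qed

text \<open>Here the hub step would have to start from the excluded sequence (5,3^5). Three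
  attachments to the wheel replace it.\<close>

lemma realizable_7443:
  "realizable {#7, 4, 4, 3, 3, 3, 3, 3#}"
proof -
  have "realizable ({#3, 3, 3#} + {#4, 3#})" using realizable_order_5(1) by (simp add: add_mset_commute)
  from realizable_attach[OF this] have "realizable ({#4, 3, 3, 3#} + {#5, 2#})"
    by (simp add: add_mset_commute numeral_eq_Suc)
  from realizable_attach[OF this] have "realizable ({#4, 3, 3, 3#} + {#6, 3, 2#})"
    by (simp add: add_mset_commute numeral_eq_Suc)
  from realizable_attach[OF this] show ?thesis
    by (simp add: add_mset_commute numeral_eq_Suc)
qed

text \<open>The order is \<open>a + 6\<close>, so \<open>d \<le> a + 5\<close> is the bound every
  simple graph obeys. The hub step lowers \<open>d\<close> and \<open>a\<close> by two each, which
  keeps this bound, and odd \<open>d\<close> descends to 5.\<close>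

lemma realizable_hub_4s_33333:
  assumes "odd d" "5 \<le> d" "d \<le> a + 5" "1 \<le> a"
  shows "realizable (replicate_mset a 4 + {#d, 3, 3, 3, 3, 3#})"
  using assms
proof (induction d arbitrary: a rule: less_induct)
  case (less d)
  show ?case
  proof (cases "d = 5")
    case True
    then show ?thesis using realizable_54s_33333 less.prems by simp
  next
    case False
    then have d: "7 \<le> d" using less.prems by (cases "d = 6") auto
    define d' c where "d' = d - 2" and "c = a - 2"
    have dc: "d = d' + 2" "a = c + 2" using d less.prems by (simp_all add: d'_def c_def)
    show ?thesis
    proof (cases "c = 0")
      case True
      then have "d = 7" using d dc less.prems by simp
      then show ?thesis using realizable_7443 by (simp add: dc True numeral_eq_Suc add_mset_commute)
    next
      case c: False
      have "realizable (replicate_mset c 4 + {#d', 3, 3, 3, 3, 3#})"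
        using less.IH[of d' c] less.prems d c by (simp add: dc)
      then have "realizable ((replicate_mset c 4 + {#3, 3, 3#}) + {#d', 3, 3#})"
        by (simp add: add_mset_commute)
      from realizable_extend_hub[OF this] show ?thesis
        by (simp add: dc numeral_eq_Suc add_mset_commute)
    qed
  qed
qed

text \<open>Deleting a cubic vertex from (6,6,4,3^4) or (6,4,4,3^4) leaves an excluded sequence, and
  from (6,5,3^5) it leaves a 2, so none of the three is reachable by the induction.\<close>

lemma realizable_sporadic:
  "realizable {#6, 5, 3, 3, 3, 3, 3#}" "realizable {#6, 6, 4, 3, 3, 3, 3#}" "realizable {#6, 4, 4, 3, 3, 3, 3#}"
proof -
  have "realizable ({#3, 3, 3#} + {#4, 3#})" using realizable_order_5(1) by (simp add: add_mset_commute)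
  from realizable_attach[OF this] have "realizable ({#3, 3, 3#} + {#5, 4, 2#})"
    by (simp add: add_mset_commute numeral_eq_Suc)
  from realizable_attach[OF this] show "realizable {#6, 5, 3, 3, 3, 3, 3#}"
    by (simp add: add_mset_commute numeral_eq_Suc)
  have "realizable ({#4, 3, 3#} + {#4, 4#})" using realizable_order_5(2) by (simp add: add_mset_commute)
  from realizable_attach[OF this] have "realizable ({#4, 3, 3#} + {#5, 5, 2#})"
    by (simp add: add_mset_commute numeral_eq_Suc)
  from realizable_attach[OF this] show "realizable {#6, 6, 4, 3, 3, 3, 3#}"
    by (simp add: add_mset_commute numeral_eq_Suc)
  have "realizable ({#3, 3#} + {#4, 3, 3#})" using realizable_order_5(1) by (simp add: add_mset_commute)
  from realizable_extend_hub[OF this] show "realizable {#6, 4, 4, 3, 3, 3, 3#}"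
    by (simp add: add_mset_commute)
qed

section \<open>Induction on the number of vertices\<close>

lemma two_valued_mset:
  assumes "set_mset M \<subseteq> {a, b}" "a \<noteq> b"
  shows "M = replicate_mset (count M a) a + replicate_mset (count M b) b"
  using assms by (intro multiset_eqI) (auto simp: not_in_iff[symmetric])

text \<open>On five vertices only the degrees 3 and 4 are possible, and an even degree sum forces an
  even number of 3s. Three sequences remain.\<close>

lemma realizable_size_5:
  assumes M: "graphic_mset M" "size M = 5" "\<And>x. x \<in># M \<Longrightarrow> 3 \<le> x"
  shows "realizable M"
proof -
  have "x = 3 \<or> x = 4" if "x \<in># M" for x
    using graphic_mset_less_size[OF M(1) that] M(2) M(3)[OF that] by linarith
  then have "set_mset M \<subseteq> {3, 4}" by blast
  then have eq: "M = replicate_mset (count M 3) 3 + replicate_mset (count M 4) 4"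
    by (rule two_valued_mset) simp
  define i j where "i = count M 3" and "j = count M 4"
  have M': "M = replicate_mset i 3 + replicate_mset j 4" unfolding i_def j_def by (rule eq)
  have ij: "i + j = 5" using M(2) by (simp add: M')
  have "even (3 * i + 4 * j)"
    using even_sum_graphic_mset[OF M(1)] by (simp add: M' mult.commute)
  then have "even i" by simp
  with ij have "i = 0 \<and> j = 5 \<or> i = 2 \<and> j = 3 \<or> i = 4 \<and> j = 1" by presburger
  then show ?thesis
    using realizable_order_5 by (auto simp: M' numeral_eq_Suc add_mset_commute)
qed

lemma top_part_exists:
  fixes M :: "nat multiset"
  assumes "d \<le> size M"
  obtains K N where "M = K + N" "size N = d" "\<forall>x\<in>#N. \<forall>y\<in>#K. y \<le> x"
proof -
  define xs where "xs = sorted_list_of_multiset M"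
  have xs: "sorted xs" "mset xs = M" by (simp_all add: xs_def)
  let ?m = "size M - d"
  have app: "take ?m xs @ drop ?m xs = xs" by simp
  have "M = mset (take ?m xs) + mset (drop ?m xs)"
    by (metis app mset_append xs(2))
  moreover have "size (mset (drop ?m xs)) = d"
    using assms arg_cong[OF xs(2), of size] by simp
  moreover have "y \<le> x" if "x \<in># mset (drop ?m xs)" "y \<in># mset (take ?m xs)" for x y
    using xs(1) that app by (metis set_mset_mset sorted_append)
  ultimately show ?thesis using that by blast
qed

lemma size_3_sortedE:
  fixes N :: "nat multiset"
  assumes "size N = 3"
  obtains x y z where "N = {#x, y, z#}" "z \<le> y" "y \<le> x"
proof -
  define xs where "xs = sorted_list_of_multiset N"
  have xs: "sorted xs" "mset xs = N" by (simp_all add: xs_def)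
  have "length xs = Suc (Suc (Suc 0))" using assms by (simp flip: xs(2))
  then obtain z y x where "xs = [z, y, x]" by (auto simp: length_Suc_conv)
  then show ?thesis using that[of x y z] xs by (auto simp: add_mset_commute)
qed

text \<open>Attaching a vertex undoes the reduction; positive entries of \<open>N\<close> ensure
  that truncated subtraction loses nothing.\<close>

lemma realizable_from_residual:
  assumes "realizable (K + image_mset (\<lambda>x. x - 1) N)" "2 \<le> size N" "\<And>x. x \<in># N \<Longrightarrow> 1 \<le> x"
  shows "realizable (add_mset (size N) (K + N))"
proof -
  have "image_mset Suc (image_mset (\<lambda>x. x - 1) N) = image_mset (\<lambda>x. x) N"
    unfolding image_mset.compositionality using assms(3) by (intro image_mset_cong) force
  then show ?thesis using realizable_attach[OF assms(1)] assms(2) by simp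
qed

abbreviation exceptional :: "nat multiset \<Rightarrow> bool" where
  "exceptional M \<equiv> M = {#5, 5, 3, 3, 3, 3#} \<or> M = {#5, 3, 3, 3, 3, 3#}"

text \<open>The lowered degrees can only be 5 or 3. One or two of them are 5 and \<open>K\<close>
  consists of 3s, which leaves (6,6,4,3^4) and (6,4,4,3^4).\<close>

lemma residual_exceptional:
  assumes R: "exceptional (K + {#x - 1, y - 1, z - 1#})"
    and ord: "z \<le> y" "y \<le> x" "\<And>k. k \<in># K \<Longrightarrow> k \<le> z" and z: "4 \<le> z"
  shows "realizable (K + {#3, x, y, z#})"
proof -
  let ?R = "K + {#x - 1, y - 1, z - 1#}"
  have "set_mset ?R \<subseteq> {5, 3}" using R by (elim disjE; simp only:; simp)
  then have R53: "v = 5 \<or> v = 3" if "v \<in># ?R" for v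
    using that by blast
  have c5: "count ?R 5 = 2 \<or> count ?R 5 = 1" using R by (elim disjE; simp only:; simp)
  have xyz: "x - 1 = 5 \<or> x - 1 = 3" "y - 1 = 5 \<or> y - 1 = 3" "z - 1 = 5 \<or> z - 1 = 3"
    by (rule R53; simp)+
  \<comment> \<open>A 5 in \<open>K\<close> would force \<open>z \<ge> 5\<close>, so all three
    lowered degrees would be 5, one too many for an excluded sequence.\<close>
  have "5 \<notin># K"
  proof
    assume "5 \<in># K"
    then have "5 \<le> z" by (rule ord(3))
    with xyz ord have "x - 1 = 5" "y - 1 = 5" "z - 1 = 5" by linarith+
    then have "3 \<le> count ?R 5" by simp
    with c5 show False by simp
  qed
  then have "k = 3" if "k \<in># K" for k using R53[of k] that by auto
  moreover have "size K = 3" using R by (auto dest: arg_cong[of _ _ size])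
  ultimately have K: "K = {#3, 3, 3#}"
    using set_mset_subset_singletonD[of K 3] by (auto simp: numeral_eq_Suc)
  have "x = 6 \<and> y = 6 \<and> z = 4 \<or> x = 6 \<and> y = 4 \<and> z = 4"
    using c5 xyz ord z unfolding K by (auto split: if_splits)
  then show ?thesis
    using realizable_sporadic by (auto simp: K add_mset_commute)
qed

text \<open>Reaching six 3s from at most four in \<open>K\<close> takes two new ones, so
  \<open>y = z = 4\<close> and \<open>K\<close> holds only 3s and 4s. If \<open>x = 4\<close>,
  parity leaves three 3s in \<open>K\<close> and the sequence is (4^a,3^4). Otherwise
  \<open>K\<close> has four 3s, \<open>x\<close> is odd, and the hub family applies.\<close>

lemma realizable_many_3s:
  assumes M: "graphic_mset (K + {#3, x, y, z#})"
    and ord: "z \<le> y" "y \<le> x" "\<And>k. k \<in># K \<Longrightarrow> k \<le> z" and K3: "\<And>k. k \<in># K \<Longrightarrow> 3 \<le> k"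
    and z: "4 \<le> z" and few: "count K 3 \<le> 4"
    and many: "6 \<le> count (K + {#x - 1, y - 1, z - 1#}) 3"
  shows "realizable (K + {#3, x, y, z#})"
proof -
  have z4: "z = 4" and y4: "y = 4"
    using many few ord z by (auto split: if_splits)
  have "set_mset K \<subseteq> {3, 4}"
  proof
    fix k assume "k \<in># K"
    then have "3 \<le> k" "k \<le> 4" using K3 ord(3) z4 by auto
    then show "k \<in> {3, 4}" by auto
  qed
  then have eq: "K = replicate_mset (count K 3) 3 + replicate_mset (count K 4) 4"
    by (rule two_valued_mset) simp
  define i j where "i = count K 3" and "j = count K 4"
  have K: "K = replicate_mset i 3 + replicate_mset j 4" unfolding i_def j_def by (rule eq)
  have i4: "i \<le> 4" using few by (simp add: i_def)
  have par: "even (3 * i + 4 * j + 11 + x)"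
    using even_sum_graphic_mset[OF M] by (simp add: K z4 y4 mult.commute algebra_simps)
  show ?thesis
  proof (cases "x = 4")
    case True
    have "3 \<le> i" using many True z4 y4 by (simp add: i_def)
    with i4 par have i: "i = 3" using True by presburger
    have "realizable (replicate_mset (j + 3) 4 + {#3, 3, 3, 3#})"
      by (rule realizable_4s_3333) simp
    then show ?thesis
      by (simp add: K i True z4 y4 numeral_eq_Suc add_mset_commute)
  next
    case False
    then have "x - Suc 0 \<noteq> 3" using ord y4 by simp
    then have i: "i = 4" using many few y4 z4 by (simp add: i_def)
    have "x < size (K + {#3, x, y, z#})" by (rule graphic_mset_less_size[OF M]) simp
    then have "x \<le> (j + 2) + 5" by (simp add: K i)
    moreover have "odd x" using par i by simp
    moreover have "5 \<le> x" using False ord y4 by simp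
    ultimately have "realizable (replicate_mset (j + 2) 4 + {#x, 3, 3, 3, 3, 3#})"
      by (intro realizable_hub_4s_33333) auto
    then show ?thesis
      by (simp add: K i z4 y4 numeral_eq_Suc add_mset_commute)
  qed
qed

text \<open>Only two degrees can exceed 3, so at most five 3s means order 6 or 7. Parity and the
  order bound leave (4^2,3^4), (5,4,3^5) and (6,5,3^5) besides the excluded sequences.\<close>

lemma realizable_third_3:
  assumes M: "graphic_mset (K + {#3, x, y, 3#})" "6 \<le> size (K + {#3, x, y, 3#})"
    and exc: "\<not> exceptional (K + {#3, x, y, 3#})"
    and ord: "3 \<le> y" "y \<le> x" and K: "\<And>k. k \<in># K \<Longrightarrow> k = 3"
    and few: "count (K + {#3, x, y, 3#}) 3 \<le> 5"
  shows "realizable (K + {#3, x, y, 3#})"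
proof -
  define m where "m = size K"
  have Kr: "K = replicate_mset m 3"
    unfolding m_def using K by (intro set_mset_subset_singletonD) auto
  have m: "m = 2 \<or> m = 3" using M(2) few by (auto simp: Kr split: if_splits)
  have x: "x < m + 4" using graphic_mset_less_size[OF M(1), of x] by (simp add: Kr)
  have "even (3 * m + 6 + x + y)"
    using even_sum_graphic_mset[OF M(1)] by (simp add: Kr mult.commute algebra_simps)
  with m have par: "m = 2 \<and> even (x + y) \<or> m = 3 \<and> odd (x + y)" by auto
  from m show ?thesis
  proof
    assume m: "m = 2"
    have Keq: "K = {#3, 3#}" by (simp add: Kr m numeral_eq_Suc)
    have "x = 3 \<or> x = 4 \<or> x = 5" "y = 3 \<or> y = 4 \<or> y = 5" using x ord m by auto
    then have "x = 3 \<and> y = 3 \<or> x = 4 \<and> y = 4 \<or> x = 5 \<and> y = 3 \<or> x = 5 \<and> y = 5"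
      using par m ord by auto
    then show ?thesis
      using exc few realizable_certified(1) by (auto simp: Keq add_mset_commute)
  next
    assume m: "m = 3"
    have Keq: "K = {#3, 3, 3#}" by (simp add: Kr m numeral_eq_Suc)
    have "y \<noteq> 3" using few by (auto simp: Keq split: if_splits)
    then have "x = 4 \<or> x = 5 \<or> x = 6" "y = 4 \<or> y = 5 \<or> y = 6" using x ord m by auto
    then have "x = 5 \<and> y = 4 \<or> x = 6 \<and> y = 5"
      using par m ord by auto
    then show ?thesis
      using realizable_certified(2) realizable_sporadic(1) by (auto simp: Keq add_mset_commute)
  qed
qed

text \<open>New 3s arise only from 4s in \<open>N\<close>, so only for \<open>d = 4\<close>, and
  then there are at most four of them; \<open>K\<close> has none. This rules out (5,3^5) at
  once.\<close>

lemma residual_not_exceptional: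
  assumes N: "size N = d" "4 \<le> d" "\<And>x. x \<in># N \<Longrightarrow> d \<le> x" and K: "\<And>k. k \<in># K \<Longrightarrow> d \<le> k"
    and top: "\<And>x y. x \<in># N \<Longrightarrow> y \<in># K \<Longrightarrow> y \<le> x"
  defines "R \<equiv> K + image_mset (\<lambda>x. x - 1) N"
  shows "count R 3 \<le> 5" "\<not> exceptional R"
proof -
  have K3: "count K 3 = 0" using K[of 3] N(2) by (auto simp: not_in_iff[symmetric])
  have le: "count R 3 \<le> 4"
  proof (cases "d = 4")
    case True
    have "count (image_mset (\<lambda>x. x - 1) N) 3 \<le> size (image_mset (\<lambda>x. x - 1) N)"
      by (rule count_le_size)
    then show ?thesis using True N(1) K3 by (simp add: R_def)
  next
    case False
    have "3 \<notin># image_mset (\<lambda>x. x - 1) N"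
    proof
      assume "3 \<in># image_mset (\<lambda>x. x - 1) N"
      then obtain x where "x \<in># N" "x - 1 = 3" by auto
      with N(3)[of x] False N(2) show False by simp
    qed
    then have "count (image_mset (\<lambda>x. x - 1) N) 3 = 0" by (simp only: not_in_iff)
    then show ?thesis using K3 by (simp add: R_def)
  qed
  then show "count R 3 \<le> 5" by simp
  show "\<not> exceptional R"
  proof
    assume exc: "exceptional R"
    with le have R: "R = {#5, 5, 3, 3, 3, 3#}" by auto
    have "K = {#}"
    proof (rule ccontr)
      assume "K \<noteq> {#}"
      then obtain k where k: "k \<in># K" by blast
      then have "k \<in># R" by (simp add: R_def)
      \<comment> \<open>If \<open>K\<close> contains a 5, every entry of \<open>N\<close> is at
        least 5 and no 3 can appear. So \<open>K\<close> is empty and \<open>N\<close> is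
        everything, giving \<open>d = 6\<close>, yet a 3 would have to come from a 4.\<close>
      then have "k = 5" using K[OF k] N(2) by (auto simp: R)
      then have "3 \<notin># image_mset (\<lambda>x. x - 1) N" using top[OF _ k] by force
      then have "count (image_mset (\<lambda>x. x - 1) N) 3 = 0" by (simp only: not_in_iff)
      then have "count R 3 = 0" using K3 by (simp add: R_def)
      then show False by (simp add: R)
    qed
    then have "d = 6" using N(1) arg_cong[OF R, of size] by (simp add: R_def)
    moreover have "3 \<in># R" by (simp add: R)
    then obtain x where "x \<in># N" "x - 1 = 3" using \<open>K = {#}\<close> by (auto simp: R_def)
    ultimately show False using N(3)[of x] by simp
  qed
qed

lemma realizable_if_graphic:
  assumes "graphic_mset M" "5 \<le> size M" "\<And>x. x \<in># M \<Longrightarrow> 3 \<le> x" "count M 3 \<le> 5" "\<not> exceptional M"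
  shows "realizable M"
  using assms
proof (induction "size M" arbitrary: M rule: less_induct)
  case less
  note M = less.prems
  show ?case
  proof (cases "size M = 5")
    case True
    then show ?thesis using realizable_size_5 M by blast
  next
    case False
    then have n: "6 \<le> size M" using M(2) by simp
    define d where "d = Min (set_mset M)"
    have d: "d \<in># M" "\<And>x. x \<in># M \<Longrightarrow> d \<le> x"
    proof -
      have "M \<noteq> {#}" using n by auto
      then show "d \<in># M" unfolding d_def by (intro Min_in) auto
      show "d \<le> x" if "x \<in># M" for x unfolding d_def using that by (intro Min_le) auto
    qed
    obtain P where P: "M = add_mset d P" using d(1) by (metis insert_DiffM)
    have "d \<le> size P" using graphic_mset_less_size[OF M(1) d(1)] by (simp add: P)
    then obtain K N where KN: "P = K + N" "size N = d" "\<forall>x\<in>#N. \<forall>y\<in>#K. y \<le> x"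
      by (rule top_part_exists)
    then have top: "y \<le> x" if "x \<in># N" "y \<in># K" for x y using that by blast
    have MKN: "M = add_mset d (K + N)" by (simp add: P KN)
    have d3: "3 \<le> d" by (rule M(3)[OF d(1)])
    let ?R = "K + image_mset (\<lambda>x. x - 1) N"
    have R: "graphic_mset ?R"
      using Havel_Hakimi[of d K N] M(1) KN(2) top by (simp add: MKN)
    have IH: "realizable M" if "\<And>x. x \<in># ?R \<Longrightarrow> 3 \<le> x" "count ?R 3 \<le> 5" "\<not> exceptional ?R"
    proof -
      have "size ?R < size M" "5 \<le> size ?R" using n by (simp_all add: MKN)
      then have "realizable ?R" using less.hyps R that by blast
      then have "realizable (add_mset (size N) (K + N))"
        by (rule realizable_from_residual) (use KN(2) d3 d(2) MKN in force)+
      then show ?thesis by (simp add: MKN KN(2))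
    qed
    show ?thesis
    proof (cases "d = 3")
      case False
      then have d4: "4 \<le> d" using d3 by simp
      have dN: "d \<le> x" if "x \<in># N" for x using d(2) that by (simp add: MKN)
      have dK: "d \<le> x" if "x \<in># K" for x using d(2) that by (simp add: MKN)
      have "3 \<le> x" if "x \<in># ?R" for x using that dN dK d4 by fastforce
      then show ?thesis
        using residual_not_exceptional[OF KN(2) d4 dN dK top] IH by blast
    next
      case True
      then obtain x y z where N: "N = {#x, y, z#}" "z \<le> y" "y \<le> x"
        using size_3_sortedE[of N] KN(2) by metis
      have M': "M = K + {#3, x, y, z#}" by (simp add: MKN True N(1) add_mset_commute)
      have R': "?R = K + {#x - 1, y - 1, z - 1#}" by (simp add: N(1))
      have Kz: "k \<le> z" if "k \<in># K" for k using top[OF _ that, of z] by (simp add: N(1))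
      have K3: "3 \<le> k" if "k \<in># K" for k using M(3) that by (simp add: M')
      have z3: "3 \<le> z" using M(3) by (simp add: M')
      show ?thesis
      \<comment> \<open>For \<open>z = 3\<close> the reduction contains a 2, and the induction
        hypothesis does not apply.\<close>
      proof (cases "z = 3")
        case True
        show ?thesis
          unfolding M' True
        proof (rule realizable_third_3)
          show "k = 3" if "k \<in># K" for k using Kz[OF that] K3[OF that] True by simp
        qed (use M n N z3 True in \<open>simp_all add: M'\<close>)
      next
        case False
        then have z4: "4 \<le> z" using z3 by simp
        \<comment> \<open>The deleted vertex is itself one of the at most five 3s.\<close>
        have c: "count K 3 \<le> 4" using M(4) by (simp add: M' split: if_splits)
        show ?thesis
        proof (cases "count ?R 3 \<le> 5")
          case False
          then have "6 \<le> count (K + {#x - 1, y - 1, z - 1#}) 3" unfolding R' by simp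
          then show ?thesis
            unfolding M' using M(1) N(2,3) Kz K3 z4 c by (intro realizable_many_3s) (simp_all add: M')
        next
          case few: True
          have "3 \<le> v" if "v \<in># ?R" for v
            using that K3 N z4 unfolding R' by auto
          moreover have "realizable M" if "exceptional ?R"
            unfolding M' by (rule residual_exceptional) (use that R' N Kz z4 in simp_all)
          ultimately show ?thesis using IH few by blast
        qed
      qed
    qed
  qed
qed

section \<open>From degree multisets back to sorted integer sequences\<close>

theorem theorem1p5:
  fixes \<pi> :: "int list" and n :: nat
  assumes "graphic \<pi>"
    and "length \<pi> = n" and "n \<ge> 6"
    and "sorted_wrt (\<ge>) \<pi>"
    and "\<pi> ! (n - 1) \<ge> 3"
    and "\<pi> ! (n - 6) \<ge> 4"
    and "\<not> (\<pi> = replicate 2 5 @ replicate 4 3 \<or> \<pi> = replicate 1 5 @ replicate 5 3)"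
  shows "has_Z3_connected_realization \<pi>"
proof -
  obtain V :: "nat set" and E where G: "simple_graph V E"
    and real: "image_mset (\<lambda>v. int (degree E v)) (mset_set V) = mset \<pi>"
    using assms(1) unfolding graphic_def realization_def by blast
  define M where "M = degree_mset V E"
  have \<pi>: "mset \<pi> = image_mset int M"
    unfolding real[symmetric] M_def degree_mset_def image_mset.compositionality comp_def ..
  have M: "M = image_mset nat (mset \<pi>)"
    by (simp add: \<pi> image_mset.compositionality comp_def)
  have desc: "\<pi> ! j \<le> \<pi> ! i" if "i \<le> j" "j < n" for i j
    using sorted_wrt_nth_less[OF assms(4), of i j] that assms(2) by (cases "i = j") auto
  have "graphic_mset M" using G by (auto simp: graphic_mset_def M_def)
  moreover have size: "size M = n" using assms(2) by (simp add: M)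
  moreover have "3 \<le> x" if "x \<in># M" for x
  proof -
    obtain v where "v \<in> set \<pi>" "x = nat v" using \<open>x \<in># M\<close> unfolding M by auto
    moreover from this obtain i where "i < n" "v = \<pi> ! i" using assms(2) by (metis in_set_conv_nth)
    moreover have "\<pi> ! (n - 1) \<le> \<pi> ! i" using \<open>i < n\<close> by (intro desc) auto
    ultimately show ?thesis using assms(5) by simp
  qed
  moreover have "count M 3 \<le> 5"
  proof -
    \<comment> \<open>With indices from 0, position \<open>n - 6\<close> is the last of the first
      \<open>n - 5\<close> entries. By monotonicity all of these are at least 4, so 3s occur only
      among the last five.\<close>
    have "3 \<notin> set (take (n - 5) \<pi>)"
    proof
      assume "3 \<in> set (take (n - 5) \<pi>)"
      then obtain i where i: "i < n - 5" "\<pi> ! i = 3"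
        using assms(2) by (auto simp: in_set_conv_nth)
      have "\<pi> ! (n - 6) \<le> \<pi> ! i" using i(1) by (intro desc) auto
      then show False using assms(6) i(2) by simp
    qed
    then have "count (mset (take (n - 5) \<pi>)) 3 = 0" by (simp add: count_eq_zero_iff)
    moreover have "count (mset (drop (n - 5) \<pi>)) 3 \<le> 5"
      using count_le_size[of "mset (drop (n - 5) \<pi>)" 3] assms(2,3) by simp
    moreover have "count (mset \<pi>) 3 = count (mset (take (n - 5) \<pi>)) 3 + count (mset (drop (n - 5) \<pi>)) 3"
      by (metis append_take_drop_id count_union mset_append)
    moreover have "count (image_mset int N) 3 = count N 3" for N
      by (induction N) auto
    then have "count (mset \<pi>) 3 = count M 3" by (simp add: \<pi>)
    ultimately show ?thesis by linarith
  qed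
  moreover have "\<not> exceptional M"
  proof
    have sorted: "sorted (rev \<pi>)"
      using assms(4) by (simp add: sorted_wrt_rev)
    \<comment> \<open>The sequence and the two excluded lists are nonincreasing, so agreement as
      multisets is agreement as lists.\<close>
    have eq: "\<pi> = ys" if "mset \<pi> = mset ys" "sorted (rev ys)" for ys
      using properties_for_sort[of "rev ys" "rev \<pi>"] properties_for_sort[of "rev \<pi>" "rev \<pi>"] sorted that
      by simp
    assume "exceptional M"
    then have "mset \<pi> = mset (replicate 2 5 @ replicate 4 3) \<or> mset \<pi> = mset (replicate 1 5 @ replicate 5 3)"
      unfolding \<pi> by (auto simp: numeral_eq_Suc)
    then have "\<pi> = replicate 2 5 @ replicate 4 3 \<or> \<pi> = replicate 1 5 @ replicate 5 3"
      by (elim disjE; intro disjI1 disjI2 eq) (auto simp: numeral_eq_Suc)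
    with assms(7) show False by blast
  qed
  ultimately have "realizable M" using assms(3) by (intro realizable_if_graphic) auto
  then obtain V' E' where G': "simple_graph V' E'" "conn V' (mset_set E')" "degree_mset V' E' = M"
    unfolding realizable_def by blast
  have "realization V' E' \<pi>"
    unfolding realization_def \<pi> G'(3)[symmetric] degree_mset_def
    using G'(1) by (simp add: image_mset.compositionality comp_def)
  then show ?thesis
    using Z3_connected_if_conn[OF G'(1,2)] unfolding has_Z3_connected_realization_def by blast
qed

end
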